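(* Let $d\ge 1$, $\alpha\in(0,2)$, $\beta\in(0,1)$ and $0<\eta\le \frac{\alpha}{\beta d}$. Let $V_0:\mathbb{R}^d\to[0,\infty)$ be a measurable function with $V_0\not\equiv 0$, and let $V:(0,\infty)\times\mathbb{R}^d\to[0,\infty]$ be a measurable function satisfying, for all $t>0$ and $x\in\mathbb{R}^d$, $$V(t,x)=\int_{\mathbb{R}^d}G(t,x-y)V_0(y)\,dy+\int_{\mathbb{R}^d}\int_0^t G(t-s,x-y)V(s,y)^{1+\eta}\,ds\,dy.$$ Then $V$ is not a global solution, in the sense that there exists $t_0>0$ such that $V(t,x)=\infty$ for all $t>t_0$ and all $x\in\mathbb{R}^d$.
   Context: $p(t,x)$ denotes the transition density of the symmetric $\alpha$-stable process on $\mathbb{R}^d$, characterized by $\int_{\mathbb{R}^d}e^{i\xi\cdot x}p(t,x)\,dx=e^{-t|\xi|^\alpha}$. $g_\beta$ is the density of $D_1$, where $D$ is a $\beta$-stable subordinator with $\mathbb{E}e^{-sD_t}=e^{-ts^\beta}$. The kernel $G$ is defined by $G(t,x)=\int_0^\infty p\big((t/u)^\beta,x\big)g_\beta(u)\,du$; it is the fundamental solution (heat kernel) of $\partial_t^\beta V=-(-\Delta)^{\alpha/2}V$ with Caputo time derivative $\partial_t^\beta$ of order $\beta$. A function satisfying the displayed integral equation is the integral solution of $\partial^\beta_tV=-(-\Delta)^{\alpha/2}V+I^{1-\beta}_t[V^{1+\eta}]$, $V(0,\cdot)=V_0$, where $I^{1-\beta}_tf(t)=\frac{1}{\Gamma(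1-\beta)}\int_0^t(t-\tau)^{-\beta}f(\tau)d\tau$.
   Formalization: The condition that V_0 is not identically 0 is taken to mean that V_0 is not zero almost everywhere; if V_0 is nonzero only on a null set, V = 0 solves the equation and the claim fails. *)

theory Defs
  imports "HOL-Analysis.Analysis"
begin

text \<open>Transition density of the symmetric alpha-stable process on the euclidean space 'a,
  i.e. the function whose Fourier transform is exp(-t |xi|^alpha), given by Fourier inversion
  (it is real and even, so the inversion integral reduces to a cosine integral).\<close>
definition stable_density :: "real \<Rightarrow> real \<Rightarrow> 'a::euclidean_space \<Rightarrow> real" where
  "stable_density \<alpha> t x =
     (1 / (2 * pi) ^ DIM('a)) *
     (\<integral> \<xi>. cos (\<xi> \<bullet> x) * exp (- t * norm \<xi> powr \<alpha>) \<partial>lborel)"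

text \<open>Density of D_1 for the beta-stable subordinator D with E exp(-s D_t) = exp(-t s^beta):
  a nonnegative measurable density on (0,oo) with the prescribed Laplace transform
  (unique up to null sets, which does not affect the kernel G below).\<close>
definition subord_density :: "real \<Rightarrow> real \<Rightarrow> real" where
  "subord_density \<beta> = (SOME g. g \<in> borel_measurable borel \<and> (\<forall>u. 0 \<le> g u) \<and>
      (\<forall>s\<ge>0. (\<integral>\<^sup>+ u\<in>{0<..}. ennreal (exp (- s * u) * g u) \<partial>lborel)
               = ennreal (exp (- (s powr \<beta>)))))"

definition Gkernel :: "real \<Rightarrow> real \<Rightarrow> real \<Rightarrow> 'a::euclidean_space \<Rightarrow> real" where
  "Gkernel \<alpha> \<beta> t x =
     (\<integral> u\<in>{0<..}. stable_density \<alpha> ((t / u) powr \<beta>) x * subord_density \<beta> u \<partial>lborel)"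

definition enn_powr :: "ennreal \<Rightarrow> real \<Rightarrow> ennreal" where
  "enn_powr v q = (if v = \<infinity> then \<infinity> else ennreal (enn2real v powr q))"

end

theory Submission
  imports Defs "HOL-Probability.Probability"
begin

text \<open>
  Write \<open>\<gamma> = \<beta> / \<alpha>\<close> and \<open>k = \<gamma> d\<close>. All that the blow-up argument needs of the kernel is a lower bound
  \<open>G t z \<ge> c t powr (- k)\<close> on \<open>0 < |z| \<le> M t powr \<gamma>\<close>. The linear part then gives \<open>V \<ge> c t powr (- k)\<close> for
  \<open>|x| \<le> t powr \<gamma>\<close> and large \<open>t\<close>; feeding this into the nonlinear term and using \<open>k \<eta> \<le> 1\<close> improves it by a factor
  \<open>ln t\<close>. On the time window \<open>(T, 2 T]\<close> and the ball of radius \<open>T powr \<gamma>\<close> the solution therefore starts from a level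
  \<open>m\<close> with \<open>T m powr \<eta>\<close> large, and iterating the nonlinear term over the times \<open>T (2 - 2^-n)\<close> drives it to infinity
  before \<open>2 T\<close>. The infinity then spreads to all of space because \<open>G\<close> is positive.

  The kernel bound rests on the existence of the \<open>\<beta>\<close>-stable subordinator density, for which a choice operator is used
  in the definitions. A law \<open>\<mu>\<close> with Laplace transform \<open>exp (- s powr \<beta>)\<close> is a weak limit of convolution powers
  of Pareto laws, and then
  \<open>g u = \<beta> / (\<Gamma> (1 - \<beta>) u) \<integral> (u - v) powr (- \<beta>) d\<mu>(v)\<close> (over \<open>v < u\<close>) is a density of \<open>\<mu>\<close>: the derivative of
  the Laplace transform is \<open>- \<beta> s powr (\<beta> - 1) exp (- s powr \<beta>)\<close>, so \<open>u \<mu>(du)\<close> is the convolution of \<open>\<mu>\<close> with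
  an explicit density. The \<open>\<alpha>\<close>-stable density is a mixture of Gaussian heat kernels by the same result for
  \<open>\<alpha> / 2\<close>, whence its positivity and its bounds.
\<close>

section \<open>The stable subordinator density\<close>

lemma nn_integral_powr_exp:
  fixes a r :: real
  assumes "0 < a" "0 < r"
  shows "(\<integral>\<^sup>+v\<in>{0<..}. ennreal (v powr (a - 1) * exp (- (r * v))) \<partial>lborel) = ennreal (Gamma a * r powr (- a))"
    (is "?I = _")
proof -
  have "ennreal (Gamma a) = (\<integral>\<^sup>+t. ennreal (indicator {0..} t * t powr (a - 1) / exp t) \<partial>lborel)"
    by (rule Gamma_conv_nn_integral_real) fact
  also have "\<dots> = ennreal r * (\<integral>\<^sup>+v. ennreal (indicator {0..} (r * v) * (r * v) powr (a - 1) / exp (r * v)) \<partial>lborel)"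
    using assms by (subst nn_integral_real_affine[where c=r and t=0]) auto
  also have "(\<integral>\<^sup>+v. ennreal (indicator {0..} (r * v) * (r * v) powr (a - 1) / exp (r * v)) \<partial>lborel) =
      (\<integral>\<^sup>+v. ennreal (r powr (a - 1)) * (ennreal (v powr (a - 1) * exp (- (r * v))) * indicator {0<..} v) \<partial>lborel)"
    using assms
    by (intro nn_integral_cong)
       (auto simp: indicator_def powr_mult exp_minus divide_simps zero_le_mult_iff ennreal_mult'[symmetric])
  also have "\<dots> = ennreal (r powr (a - 1)) * ?I"
    by (rule nn_integral_cmult) auto
  also have "ennreal r * (ennreal (r powr (a - 1)) * ?I) = ennreal (r powr a) * ?I"
    using assms by (simp add: mult.assoc[symmetric] ennreal_mult'[symmetric] powr_mult_base)
  finally have "ennreal (Gamma a) = ennreal (r powr a) * ?I" .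
  hence "ennreal (r powr (- a)) * ennreal (Gamma a) = ennreal (r powr (- a)) * ennreal (r powr a) * ?I"
    by (simp add: mult.assoc)
  also have "ennreal (r powr (- a)) * ennreal (r powr a) = 1"
    using assms by (simp add: ennreal_mult'[symmetric] powr_add[symmetric])
  finally show ?thesis
    using assms by (simp add: ennreal_mult'[symmetric] mult.commute)
qed

lemma nn_integral_powr_from_0:
  fixes b s :: real
  assumes "0 < b" "0 \<le> s"
  shows "(\<integral>\<^sup>+r. ennreal (r powr (b - 1)) * indicator {0..s} r \<partial>lborel) = ennreal (s powr b / b)"
  using nn_integral_has_integral_lebesgue'[OF _ has_integral_powr_from_0[of "b - 1" s]] assms by simp

text \<open>Levy-Khintchine formula for the measure b x^(-b-1) dx. Writing 1 - exp (- s x) as the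
  integral of x exp (- r x) over r in [0, s] and swapping the integrals leaves a Gamma integral in x
  and then a power of r.\<close>

lemma nn_integral_levy_measure:
  fixes b s :: real
  assumes b: "0 < b" "b < 1" and s: "0 \<le> s"
  shows "(\<integral>\<^sup>+x\<in>{0<..}. ennreal ((1 - exp (- (s * x))) * (b * x powr (- b - 1))) \<partial>lborel) =
         ennreal (Gamma (1 - b) * s powr b)"
proof -
  have inner: "ennreal (1 - exp (- (s * x))) = (\<integral>\<^sup>+r. ennreal (x * exp (- (r * x))) * indicator {0..s} r \<partial>lborel)"
    if "0 < x" for x
  proof -
    have "(\<integral>\<^sup>+r. ennreal (x * exp (- (r * x))) * indicator {0..s} r \<partial>lborel) =
            ennreal (- exp (- (s * x)) - (- exp (- (0 * x))))"
      using that s by (intro nn_integral_FTC_Icc) (auto intro!: derivative_eq_intros)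
    thus ?thesis by simp
  qed
  have "(\<integral>\<^sup>+x\<in>{0<..}. ennreal ((1 - exp (- (s * x))) * (b * x powr (- b - 1))) \<partial>lborel) =
    (\<integral>\<^sup>+x. (\<integral>\<^sup>+r. ennreal (b * x powr (- b) * exp (- (r * x))) * indicator {0..s} r * indicator {0<..} x \<partial>lborel) \<partial>lborel)"
  proof (rule nn_integral_cong)
    fix x :: real
    show "ennreal ((1 - exp (- (s * x))) * (b * x powr (- b - 1))) * indicator {0<..} x =
      (\<integral>\<^sup>+r. ennreal (b * x powr (- b) * exp (- (r * x))) * indicator {0..s} r * indicator {0<..} x \<partial>lborel)"
    proof (cases "0 < x")
      case True
      have "ennreal ((1 - exp (- (s * x))) * (b * x powr (- b - 1))) =
              ennreal (b * x powr (- b - 1)) * ennreal (1 - exp (- (s * x)))"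
        using b by (subst ennreal_mult'[symmetric]) (auto simp: mult.commute)
      also have "\<dots> = (\<integral>\<^sup>+r. ennreal (b * x powr (- b - 1)) * (ennreal (x * exp (- (r * x))) * indicator {0..s} r) \<partial>lborel)"
        unfolding inner[OF True] by (rule nn_integral_cmult[symmetric]) auto
      also have "\<dots> = (\<integral>\<^sup>+r. ennreal (b * x powr (- b) * exp (- (r * x))) * indicator {0..s} r \<partial>lborel)"
      proof (rule nn_integral_cong)
        fix r
        have "x powr (- b) = x powr (- b - 1) * x"
          using powr_mult_base[of x "- b - 1"] True by (simp add: mult.commute)
        thus "ennreal (b * x powr (- b - 1)) * (ennreal (x * exp (- (r * x))) * indicator {0..s} r) =
          ennreal (b * x powr (- b) * exp (- (r * x))) * indicator {0..s} r"
          using True b by (simp add: mult.assoc[symmetric] ennreal_mult'[symmetric])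
      qed
      finally show ?thesis using True by simp
    qed simp
  qed
  also have "\<dots> = (\<integral>\<^sup>+r. (\<integral>\<^sup>+x. ennreal (b * x powr (- b) * exp (- (r * x))) * indicator {0..s} r * indicator {0<..} x \<partial>lborel) \<partial>lborel)"
    by (rule lborel_pair.Fubini') measurable
  also have "\<dots> = (\<integral>\<^sup>+r. ennreal (b * Gamma (1 - b)) * (ennreal (r powr (b - 1)) * indicator {0..s} r) \<partial>lborel)"
  \<comment> \<open>The two sides differ at r = 0, where the left one is infinite but
    \<open>0 powr (b - 1)\<close> is 0, so equality is claimed only almost everywhere.\<close>
  proof (rule nn_integral_cong_AE, rule AE_mp[OF AE_lborel_singleton[of 0]], rule AE_I2, rule impI)
    fix r :: real
    assume "r \<noteq> 0"
    show "(\<integral>\<^sup>+x. ennreal (b * x powr (- b) * exp (- (r * x))) * indicator {0..s} r * indicator {0<..} x \<partial>lborel) =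
       ennreal (b * Gamma (1 - b)) * (ennreal (r powr (b - 1)) * indicator {0..s} r)"
    proof (cases "r \<in> {0..s}")
      case True
      with \<open>r \<noteq> 0\<close> have r: "0 < r" by simp
      have "(\<integral>\<^sup>+x. ennreal (b * x powr (- b) * exp (- (r * x))) * indicator {0..s} r * indicator {0<..} x \<partial>lborel) =
         (\<integral>\<^sup>+x. ennreal b * (ennreal (x powr ((1 - b) - 1) * exp (- (r * x))) * indicator {0<..} x) \<partial>lborel)"
        using True b by (intro nn_integral_cong) (auto simp: indicator_def ennreal_mult'[symmetric] mult.assoc)
      also have "\<dots> = ennreal b * ennreal (Gamma (1 - b) * r powr (- (1 - b)))"
        using b nn_integral_powr_exp[OF _ r, of "1 - b"] by (subst nn_integral_cmult) auto
      finally show ?thesis using True b by (simp add: ennreal_mult'[symmetric] mult.assoc)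
    qed simp
  qed
  also have "\<dots> = ennreal (b * Gamma (1 - b)) * ennreal (s powr b / b)"
    using b s by (subst nn_integral_cmult) (auto simp: nn_integral_powr_from_0)
  also have "\<dots> = ennreal (Gamma (1 - b) * s powr b)"
    using b by (subst ennreal_mult'[symmetric]) auto
  finally show ?thesis .
qed

section \<open>The stable law as a limit of convolution powers of Pareto laws\<close>

primrec conv_power :: "real measure \<Rightarrow> nat \<Rightarrow> real measure" where
  "conv_power M 0 = return borel 0"
| "conv_power M (Suc n) = convolution M (conv_power M n)"

lemma real_distribution_conv_power:
  assumes "real_distribution M"
  shows "real_distribution (conv_power M n)"
proof (induction n)
  case 0
  show ?case
    by (auto simp: real_distribution_def real_distribution_axioms_def intro!: prob_space_return)
next
  case (Suc n)
  interpret M: real_distribution M by fact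
  interpret N: real_distribution "conv_power M n" by fact
  interpret P: pair_prob_space M "conv_power M n" ..
  have "prob_space (convolution M (conv_power M n))"
    unfolding convolution_def by (intro P.prob_space_distr) measurable
  thus ?case
    by (auto simp: real_distribution_def real_distribution_axioms_def)
qed

text \<open>Both claims go through one induction because the transform factorizes only on the
  support: \<open>max (x + y) 0\<close> splits into the two truncations when both summands are
  nonnegative. The truncation \<open>max x 0\<close> keeps the integrand bounded and continuous on
  the whole line for s \<ge> 0, as weak convergence will require.\<close>

lemma conv_power_support_laplace:
  assumes M: "real_distribution M" and pos: "AE x in M. 0 \<le> x"
  shows "AE x in conv_power M n. 0 \<le> x"
    and "(\<integral>\<^sup>+x. ennreal (exp (- (s * max x 0))) \<partial>conv_power M n) =
         (\<integral>\<^sup>+x. ennreal (exp (- (s * max x 0))) \<partial>M) ^ n"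
proof (induction n)
  case 0
  { case 1 show ?case unfolding conv_power.simps by (subst AE_return) auto }
  { case 2 show ?case by (simp add: nn_integral_return) }
next
  case (Suc n)
  interpret M: real_distribution M by fact
  interpret N: real_distribution "conv_power M n" by (rule real_distribution_conv_power) fact
  interpret P: pair_prob_space M "conv_power M n" ..
  have I: "(\<integral>\<^sup>+x. f x \<partial>conv_power M (Suc n)) = (\<integral>\<^sup>+x. \<integral>\<^sup>+y. f (x + y) \<partial>conv_power M n \<partial>M)"
    if "f \<in> borel_measurable borel" for f
    using that by (simp add: nn_integral_convolution M.finite_measure_axioms N.finite_measure_axioms)
  { case 1
    have "(\<integral>\<^sup>+x. indicator {..<0} x \<partial>conv_power M (Suc n)) =
            (\<integral>\<^sup>+x. \<integral>\<^sup>+y. indicator {..<0} (x + y) \<partial>conv_power M n \<partial>M)"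
      by (rule I) auto
    also have "\<dots> = (\<integral>\<^sup>+x. \<integral>\<^sup>+y. 0 \<partial>conv_power M n \<partial>M)"
    proof (rule nn_integral_cong_AE, rule AE_mp[OF pos], rule AE_I2, rule impI)
      fix x :: real assume x: "0 \<le> x"
      show "(\<integral>\<^sup>+y. indicator {..<0} (x + y) \<partial>conv_power M n) = (\<integral>\<^sup>+y. 0 \<partial>conv_power M n)"
        using Suc(1) x by (intro nn_integral_cong_AE) (auto elim!: eventually_mono simp: indicator_def)
    qed
    finally have "(\<integral>\<^sup>+x. indicator {..<0} x \<partial>conv_power M (Suc n)) = 0"
      by simp
    hence "AE x in conv_power M (Suc n). indicator {..<0} x = (0::ennreal)"
      by (subst (asm) nn_integral_0_iff_AE) simp_all
    thus ?case
      by eventually_elim (simp add: indicator_def not_less split: if_splits) }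
  { case 2
    let ?L = "\<integral>\<^sup>+x. ennreal (exp (- (s * max x 0))) \<partial>M"
    have "(\<integral>\<^sup>+x. ennreal (exp (- (s * max x 0))) \<partial>conv_power M (Suc n)) =
            (\<integral>\<^sup>+x. \<integral>\<^sup>+y. ennreal (exp (- (s * max (x + y) 0))) \<partial>conv_power M n \<partial>M)"
      by (rule I) auto
    also have "\<dots> = (\<integral>\<^sup>+x. ennreal (exp (- (s * max x 0))) * ?L ^ n \<partial>M)"
    proof (rule nn_integral_cong_AE, rule AE_mp[OF pos], rule AE_I2, rule impI)
      fix x :: real assume x: "0 \<le> x"
      have "(\<integral>\<^sup>+y. ennreal (exp (- (s * max (x + y) 0))) \<partial>conv_power M n) =
              (\<integral>\<^sup>+y. ennreal (exp (- (s * max x 0))) * ennreal (exp (- (s * max y 0))) \<partial>conv_power M n)"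
      proof (rule nn_integral_cong_AE, rule AE_mp[OF Suc(1)], rule AE_I2, rule impI)
        fix y :: real assume y: "0 \<le> y"
        have "- (s * max (x + y) 0) = - (s * max x 0) + - (s * max y 0)"
          using x y by (simp add: distrib_left)
        thus "ennreal (exp (- (s * max (x + y) 0))) = ennreal (exp (- (s * max x 0))) * ennreal (exp (- (s * max y 0)))"
          by (simp only: exp_add ennreal_mult' exp_ge_zero)
      qed
      also have "\<dots> = ennreal (exp (- (s * max x 0))) * ?L ^ n"
        unfolding Suc(2)[symmetric] by (rule nn_integral_cmult) auto
      finally show "(\<integral>\<^sup>+y. ennreal (exp (- (s * max (x + y) 0))) \<partial>conv_power M n) = ennreal (exp (- (s * max x 0))) * ?L ^ n" .
    qed
    also have "\<dots> = ?L * ?L ^ n" by (rule nn_integral_multc) auto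
    finally show ?case by simp }
qed

text \<open>The Levy measure b x^(-b-1) dx cut off below \<open>e\<close>. What remains has mass
  \<open>e powr (- b)\<close>, hence the normalizing factor \<open>e powr b\<close>.\<close>

definition pareto :: "real \<Rightarrow> real \<Rightarrow> real measure" where
  "pareto b e = density lborel (\<lambda>x. ennreal (b * e powr b * x powr (- b - 1)) * indicator {e..} x)"

text \<open>The third claim concerns one minus the Laplace transform, because this deficit times the
  number of summands is what converges: it is a truncated Levy integral.\<close>

lemma
  assumes b: "0 < b" and e: "0 < e"
  shows real_distribution_pareto: "real_distribution (pareto b e)"
    and AE_pareto_nonneg: "AE x in pareto b e. 0 \<le> x"
    and nn_integral_pareto_deficit: "(\<integral>\<^sup>+x. ennreal (1 - exp (- (s * max x 0))) \<partial>pareto b e) =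
      ennreal (e powr b) * (\<integral>\<^sup>+x. ennreal ((1 - exp (- (s * x))) * (b * x powr (- b - 1))) * indicator {e..} x \<partial>lborel)"
proof -
  have "emeasure (pareto b e) (space (pareto b e)) =
     (\<integral>\<^sup>+x. ennreal (b * e powr b) * (ennreal (x powr (- b - 1)) * indicator {e..} x) \<partial>lborel)"
    using b e unfolding pareto_def
    by (subst emeasure_density) (auto intro!: nn_integral_cong simp: ennreal_mult'[symmetric] mult.assoc[symmetric])
  also have "\<dots> = ennreal (b * e powr b) * ennreal (- (e powr (- b - 1 + 1)) / (- b - 1 + 1))"
    using b e nn_integral_has_integral_lebesgue'[OF _ has_integral_powr_to_inf[of "- b - 1" e]]
    by (subst nn_integral_cmult) auto
  also have "\<dots> = 1"
    using b e by (subst ennreal_mult'[symmetric]) (auto simp: powr_minus field_simps)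
  finally have "prob_space (pareto b e)"
    by (rule prob_spaceI)
  thus "real_distribution (pareto b e)"
    by (simp add: real_distribution_def real_distribution_axioms_def pareto_def)
  show "AE x in pareto b e. 0 \<le> x"
    using e unfolding pareto_def by (subst AE_density) (auto simp: indicator_def)
  show "(\<integral>\<^sup>+x. ennreal (1 - exp (- (s * max x 0))) \<partial>pareto b e) =
      ennreal (e powr b) * (\<integral>\<^sup>+x. ennreal ((1 - exp (- (s * x))) * (b * x powr (- b - 1))) * indicator {e..} x \<partial>lborel)"
    unfolding pareto_def using b e
    by (subst nn_integral_density, simp, simp, subst nn_integral_cmult[symmetric], simp, intro nn_integral_cong)
       (auto simp: indicator_def max_def ennreal_mult'[symmetric] ennreal_mult''[symmetric] mult_ac)
qed

text \<open>Poisson-type limit theorem. The sum of n + 1 independent Pareto variables has transform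
  (1 - d)^(n+1), where (n + 1) d tends to s^b as the cutoff decreases to 0. The same bound on (n +
  1) d gives tightness, and a weak subsequential limit inherits the limiting transform.\<close>

lemma exists_stable_law:
  fixes b :: real
  assumes b: "0 < b" "b < 1"
  shows "\<exists>M. real_distribution M \<and> (\<forall>s\<ge>0. (LINT x|M. exp (- (s * max x 0))) = exp (- (s powr b)))"
proof -
  define c where "c = Gamma (1 - b)"
  have c: "c > 0" using b by (simp add: c_def Gamma_real_pos)
  \<comment> \<open>The cutoff solves \<open>real (Suc n) * e n powr b = 1 / c\<close>, so that n +
    1 deficits add up to 1 / c times the Levy integral truncated at \<open>e n\<close>. The factor 1
    / c cancels the \<open>Gamma (1 - b)\<close> of the full integral.\<close>
  define e where "e n = (c * real (Suc n)) powr (- 1 / b)" for n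
  have e: "e n > 0" for n using c by (simp add: e_def)
  have eb: "e n powr b = 1 / (c * real (Suc n))" for n
  proof -
    have "e n powr b = (c * real (Suc n)) powr (- 1)"
      using b by (simp add: e_def powr_powr)
    thus ?thesis using c by (simp add: powr_minus_divide)
  qed
  define \<nu> where "\<nu> n = pareto b (e n)" for n
  define \<mu> where "\<mu> n = conv_power (\<nu> n) (Suc n)" for n
  define h where "h s x = exp (- (s * max x 0))" for s x :: real
  have h_bounds: "0 \<le> h s x" "h s x \<le> 1" if "s \<ge> 0" for s x
    using that by (auto simp: h_def)
  have h_meas [measurable]: "h s \<in> borel_measurable borel" for s
    unfolding h_def by measurable
  have \<nu>: "real_distribution (\<nu> n)" "AE x in \<nu> n. 0 \<le> x" for n
    unfolding \<nu>_def using b e by (auto intro: real_distribution_pareto AE_pareto_nonneg)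
  have \<mu>: "real_distribution (\<mu> n)" for n
    unfolding \<mu>_def by (intro real_distribution_conv_power \<nu>)
  have h_int: "integrable M (h s)" if "real_distribution M" "s \<ge> 0" for M s
  proof -
    interpret real_distribution M by fact
    show ?thesis using h_bounds[OF that(2)]
      by (intro integrable_const_bound[where B=1]) (auto simp: abs_le_iff)
  qed
  define d where "d n s = (LINT x|\<nu> n. 1 - h s x)" for n s
  define J where "J n s = (\<integral>\<^sup>+x. ennreal ((1 - exp (- (s * x))) * (b * x powr (- b - 1))) * indicator {e n..} x \<partial>lborel)" for n s
  have d_bounds: "0 \<le> d n s" "d n s \<le> 1" "(LINT x|\<nu> n. h s x) = 1 - d n s" if "s \<ge> 0" for n s
  proof -
    interpret real_distribution "\<nu> n" by (rule \<nu>)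
    show "0 \<le> d n s" unfolding d_def
      using h_bounds[OF that] by (intro Bochner_Integration.integral_nonneg) auto
    show I: "(LINT x|\<nu> n. h s x) = 1 - d n s"
      unfolding d_def using h_int[OF \<nu>(1) that] prob_space by simp
    have "0 \<le> (LINT x|\<nu> n. h s x)"
      using h_bounds[OF that] by (intro Bochner_Integration.integral_nonneg) auto
    thus "d n s \<le> 1" using I by simp
  qed
  have d_J: "ennreal (real (Suc n) * d n s) = ennreal (1 / c) * J n s" if "s \<ge> 0" for n s
  proof -
    interpret real_distribution "\<nu> n" by (rule \<nu>)
    have "ennreal (d n s) = (\<integral>\<^sup>+x. ennreal (1 - h s x) \<partial>\<nu> n)"
      unfolding d_def using h_bounds[OF that] h_int[OF \<nu>(1) that]
      by (intro nn_integral_eq_integral[symmetric]) auto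
    also have "\<dots> = ennreal (e n powr b) * J n s"
      unfolding h_def \<nu>_def J_def using b e by (intro nn_integral_pareto_deficit)
    finally have "ennreal (real (Suc n) * d n s) = ennreal (real (Suc n)) * (ennreal (e n powr b) * J n s)"
      by (simp add: ennreal_mult')
    also have "\<dots> = ennreal (real (Suc n) * e n powr b) * J n s"
      by (simp add: ennreal_mult' mult.assoc)
    also have "real (Suc n) * e n powr b = 1 / c"
      unfolding eb using c by (simp del: of_nat_Suc)
    finally show ?thesis .
  qed
  have J_full: "ennreal (1 / c) * (\<integral>\<^sup>+x\<in>{0<..}. ennreal ((1 - exp (- (s * x))) * (b * x powr (- b - 1))) \<partial>lborel) = ennreal (s powr b)"
    if "s \<ge> 0" for s
    unfolding nn_integral_levy_measure[OF b that] using c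
    by (subst ennreal_mult'[symmetric]) (auto simp: c_def)
  have J_le: "ennreal (1 / c) * J n s \<le> ennreal (s powr b)" if "s \<ge> 0" for n s
    unfolding J_full[OF that, symmetric] J_def
    using e[of n] by (intro mult_left_mono nn_integral_mono) (auto simp: indicator_def)
  have e_decseq: "e n \<le> e m" if "m \<le> n" for m n
    unfolding e_def using that c b by (intro powr_mono2') (auto simp: divide_nonpos_pos)
  have e_lim: "e \<longlonglongrightarrow> 0"
  proof -
    have "filterlim (\<lambda>n. c * real (Suc n)) at_top sequentially"
      using c by (intro filterlim_tendsto_pos_mult_at_top[OF tendsto_const]
          filterlim_compose[OF filterlim_real_sequentially filterlim_Suc])
    thus ?thesis
      unfolding e_def using b by (intro tendsto_neg_powr) auto
  qed
  have J_lim: "(\<lambda>n. J n s) \<longlonglongrightarrow> (\<integral>\<^sup>+x\<in>{0<..}. ennreal ((1 - exp (- (s * x))) * (b * x powr (- b - 1))) \<partial>lborel)" for s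
    unfolding J_def
  proof (rule nn_integral_LIMSEQ)
    show "incseq (\<lambda>n x. ennreal ((1 - exp (- (s * x))) * (b * x powr (- b - 1))) * indicator {e n..} x)"
      using e_decseq by (force simp: incseq_def le_fun_def indicator_def)
    fix x :: real
    show "(\<lambda>n. ennreal ((1 - exp (- (s * x))) * (b * x powr (- b - 1))) * indicator {e n..} x) \<longlonglongrightarrow>
        ennreal ((1 - exp (- (s * x))) * (b * x powr (- b - 1))) * indicator {0<..} x"
    proof (cases "x > 0")
      case True
      have "eventually (\<lambda>n. e n < x) sequentially"
        using e_lim True by (rule order_tendstoD)
      hence "eventually (\<lambda>n. ennreal ((1 - exp (- (s * x))) * (b * x powr (- b - 1))) * indicator {e n..} x = ennreal ((1 - exp (- (s * x))) * (b * x powr (- b - 1))) * indicator {0<..} x) sequentially"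
        by eventually_elim (use True in \<open>auto simp: indicator_def\<close>)
      thus ?thesis by (rule tendsto_eventually)
    next
      case False
      hence "indicator {e n..} x = (0::ennreal)" for n using e[of n] by (auto simp: indicator_def)
      thus ?thesis using False by simp
    qed
  qed auto
  have d_le: "real (Suc n) * d n s \<le> s powr b" if "s \<ge> 0" for n s
    using J_le[OF that, of n] unfolding d_J[OF that, symmetric] by (simp add: ennreal_le_iff)
  have d_lim: "(\<lambda>n. real (Suc n) * d n s) \<longlonglongrightarrow> s powr b" if "s \<ge> 0" for s
  proof -
    have "(\<lambda>n. ennreal (1 / c) * J n s) \<longlonglongrightarrow> ennreal (s powr b)"
      unfolding J_full[OF that, symmetric] by (intro ennreal_tendsto_cmult J_lim) auto
    hence "(\<lambda>n. ennreal (real (Suc n) * d n s)) \<longlonglongrightarrow> ennreal (s powr b)"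
      unfolding d_J[OF that] .
    thus ?thesis
      using d_bounds[OF that] by (subst (asm) tendsto_ennreal_iff) auto
  qed
  have \<mu>_h: "(LINT x|\<mu> n. h s x) = (1 - d n s) ^ Suc n" if "s \<ge> 0" for n s
  proof -
    have "ennreal (LINT x|\<mu> n. h s x) = (\<integral>\<^sup>+x. ennreal (h s x) \<partial>\<mu> n)"
      using h_bounds[OF that] by (intro nn_integral_eq_integral[symmetric] h_int \<mu> that) auto
    also have "\<dots> = (\<integral>\<^sup>+x. ennreal (h s x) \<partial>\<nu> n) ^ Suc n"
      unfolding \<mu>_def h_def by (intro conv_power_support_laplace \<nu>)
    also have "(\<integral>\<^sup>+x. ennreal (h s x) \<partial>\<nu> n) = ennreal (1 - d n s)"
      using h_bounds[OF that] d_bounds[OF that] by (subst nn_integral_eq_integral) (auto intro: h_int \<nu> that)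
    also have "ennreal (1 - d n s) ^ Suc n = ennreal ((1 - d n s) ^ Suc n)"
      using d_bounds[OF that] by (intro ennreal_power) auto
    finally show ?thesis
      using d_bounds[OF that] h_bounds[OF that]
      by (subst (asm) ennreal_inj) (auto intro!: Bochner_Integration.integral_nonneg)
  qed
  have \<mu>_lim: "(\<lambda>n. LINT x|\<mu> n. h s x) \<longlonglongrightarrow> exp (- (s powr b))" if "s \<ge> 0" for s
  proof -
    \<comment> \<open>\<open>E n\<close> is the exact (n+1)-st root of the target. Two numbers of
      modulus at most 1 satisfy |a^N - b^N| \<le> N |a - b|, so it is enough to compare N (1 - E)
      with N d.\<close>
    define E where "E n = exp (- (s powr b) / real (Suc n))" for n
    have bound: "\<bar>(1 - d n s) ^ Suc n - exp (- (s powr b))\<bar> \<le> \<bar>real (Suc n) * (1 - E n) - real (Suc n) * d n s\<bar>" for n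
    proof -
      have "\<bar>(1 - d n s) ^ Suc n - E n ^ Suc n\<bar> \<le> real (Suc n) * \<bar>(1 - d n s) - E n\<bar>"
        using norm_power_diff[of "1 - d n s" "E n" "Suc n"] d_bounds[OF that, of n]
        by (simp add: E_def abs_le_iff)
      moreover have "E n ^ Suc n = exp (- (s powr b))"
        unfolding E_def by (subst exp_of_nat_mult[symmetric]) simp
      moreover have "real (Suc n) * \<bar>(1 - d n s) - E n\<bar> = \<bar>real (Suc n) * ((1 - d n s) - E n)\<bar>"
        by (simp add: abs_mult)
      ultimately show ?thesis by (simp add: algebra_simps)
    qed
    have "(\<lambda>n. real (Suc n) * (1 - E n)) \<longlonglongrightarrow> s powr b"
      unfolding E_def by real_asymp
    from tendsto_diff[OF this d_lim[OF that]]
    have "(\<lambda>n. \<bar>real (Suc n) * (1 - E n) - real (Suc n) * d n s\<bar>) \<longlonglongrightarrow> 0"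
      by (auto intro: tendsto_rabs_zero)
    hence "(\<lambda>n. (1 - d n s) ^ Suc n - exp (- (s powr b))) \<longlonglongrightarrow> 0"
      by (rule tendsto_0_le[where K=1]) (use bound in auto)
    thus ?thesis
      unfolding \<mu>_h[OF that] by (simp add: LIM_zero_iff)
  qed
  have "tight \<mu>"
    unfolding tight_def
  proof (intro conjI allI impI \<mu>)
    fix \<epsilon> :: real assume \<epsilon>: "\<epsilon> > 0"
    \<comment> \<open>Beyond K the function \<open>1 - h (1 / K)\<close> is at least 1 - exp (-1),
      so the tail mass is at most K^(-b) / (1 - exp (-1)). This K makes that bound \<epsilon> / 2.
      The left end -1 is taken below 0 so that the half-open interval contains the point 0.\<close>
    define K where "K = (2 * (1 / (1 - exp (- 1))) / \<epsilon>) powr (1 / b)"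
    have K: "K > 0" using \<epsilon> by (simp add: K_def)
    have "measure (\<mu> n) {-1<..K} > 1 - \<epsilon>" for n
    proof -
      interpret real_distribution "\<mu> n" by (rule \<mu>)
      have pos: "AE x in \<mu> n. 0 \<le> x"
        unfolding \<mu>_def by (intro conv_power_support_laplace \<nu>)
      have "(1 - exp (-1)) * measure (\<mu> n) {K<..} = (LINT x|\<mu> n. (1 - exp (-1)) * indicator {K<..} x)"
        by simp
      also have "\<dots> \<le> (LINT x|\<mu> n. 1 - h (1 / K) x)"
      proof (rule Bochner_Integration.integral_mono)
        show "integrable (\<mu> n) (\<lambda>x. 1 - h (1 / K) x)"
          using K h_int[OF \<mu>, of "1/K"] by auto
        fix x
        show "(1 - exp (-1)) * indicator {K<..} x \<le> 1 - h (1 / K) x"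
          using K h_bounds[of "1/K" x] by (auto simp: indicator_def h_def)
      qed (auto intro!: integrable_const_bound[where B=1] simp: indicator_def)
      also have "\<dots> = 1 - (1 - d n (1 / K)) ^ Suc n"
        using K h_int[OF \<mu>, of "1/K"] \<mu>_h[of "1/K" n] prob_space by simp
      also have "\<dots> \<le> real (Suc n) * d n (1 / K)"
        using Bernoulli_inequality[of "- d n (1 / K)" "Suc n"] d_bounds[of "1/K" n] K by (simp add: algebra_simps)
      also have "\<dots> \<le> (1 / K) powr b"
        using K by (intro d_le) auto
      also have "\<dots> = \<epsilon> * (1 - exp (-1)) / 2"
        using \<epsilon> b by (simp add: K_def powr_divide powr_powr)
      finally have "(1 - exp (- 1)) * measure (\<mu> n) {K<..} \<le> (1 - exp (- 1)) * (\<epsilon> / 2)"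
        by (simp add: mult.commute)
      hence "measure (\<mu> n) {K<..} \<le> \<epsilon> / 2"
        by (rule mult_left_le_imp_le) simp
      moreover have "measure (\<mu> n) {-1<..} = measure (\<mu> n) UNIV"
        using pos by (intro measure_eq_AE) (auto elim!: eventually_mono)
      moreover have "measure (\<mu> n) UNIV = 1" using prob_space by simp
      moreover have "measure (\<mu> n) {-1<..} = measure (\<mu> n) {-1<..K} + measure (\<mu> n) {K<..}"
        using K by (subst finite_measure_Union[symmetric]) (auto intro!: arg_cong[where f="measure (\<mu> n)"])
      ultimately show ?thesis using \<epsilon> by linarith
    qed
    thus "\<exists>a b. a < b \<and> (\<forall>n. 1 - \<epsilon> < measure (\<mu> n) {a<..b})"
      using K by (intro exI[of _ "-1"] exI[of _ K]) auto
  qed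
  then obtain r M where r: "strict_mono (r :: nat \<Rightarrow> nat)" and M: "real_distribution M"
    and conv: "weak_conv_m (\<mu> \<circ> id \<circ> r) M"
    using tight_imp_convergent_subsubsequence[of \<mu> id] by (auto simp: strict_mono_def)
  have "(LINT x|M. h s x) = exp (- (s powr b))" if "s \<ge> 0" for s
  proof (rule LIMSEQ_unique)
    interpret real_distribution M by (rule M)
    show "(\<lambda>n. LINT x|(\<mu> \<circ> id \<circ> r) n. h s x) \<longlonglongrightarrow> (LINT x|M. h s x)"
    proof (rule weak_conv_imp_integral_bdd_continuous_conv[of _ _ _ 1])
      show "isCont (h s) x" for x
        unfolding h_def by (intro continuous_intros)
      show "norm (h s x) \<le> 1" for x using h_bounds[OF that, of x] by simp
    qed (use \<mu> M conv in \<open>auto simp: o_def\<close>)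
    show "(\<lambda>n. LINT x|(\<mu> \<circ> id \<circ> r) n. h s x) \<longlonglongrightarrow> exp (- (s powr b))"
      using LIMSEQ_subseq_LIMSEQ[OF \<mu>_lim[OF that] r] by (simp add: o_def)
  qed
  thus ?thesis using M unfolding h_def by blast
qed

section \<open>An explicit density of the stable law\<close>

lemma nn_integral_exp_atLeast:
  fixes s u :: real
  assumes "0 < u"
  shows "(\<integral>\<^sup>+r. ennreal (exp (- (r * u))) * indicator {s..} r \<partial>lborel) = ennreal (exp (- (s * u)) / u)"
proof -
  have "(\<integral>\<^sup>+r. ennreal (exp (- (r * u))) * indicator {s..} r \<partial>lborel) = ennreal (0 - (- exp (- (s * u)) / u))"
  proof (rule nn_integral_FTC_atLeast)
    show "((\<lambda>r. - exp (- (r * u)) / u) has_real_derivative exp (- (r * u))) (at r)" for r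
      using assms by (auto intro!: derivative_eq_intros)
    show "((\<lambda>r. - exp (- (r * u)) / u) \<longlongrightarrow> 0) at_top"
      using assms by real_asymp
  qed auto
  thus ?thesis by simp
qed

lemma nn_integral_powr_exp_atLeast:
  fixes b s :: real
  assumes b: "0 < b" and s: "0 < s"
  shows "(\<integral>\<^sup>+r. ennreal (b * r powr (b - 1) * exp (- (r powr b))) * indicator {s..} r \<partial>lborel) = ennreal (exp (- (s powr b)))"
proof -
  have "(\<integral>\<^sup>+r. ennreal (b * r powr (b - 1) * exp (- (r powr b))) * indicator {s..} r \<partial>lborel) =
         ennreal (0 - (- exp (- (s powr b))))"
  proof (rule nn_integral_FTC_atLeast)
    fix r assume "s \<le> r"
    thus "((\<lambda>r. - exp (- (r powr b))) has_real_derivative b * r powr (b - 1) * exp (- (r powr b))) (at r)"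
      using s by (auto intro!: derivative_eq_intros)
    show "0 \<le> b * r powr (b - 1) * exp (- (r powr b))" using b by simp
  next
    show "((\<lambda>r. - exp (- (r powr b))) \<longlongrightarrow> 0) at_top"
      using b by real_asymp
  qed auto
  thus ?thesis by simp
qed

text \<open>The constant b / Gamma (1 - b) makes b r^(b-1), the derivative of r^b, the Laplace
  transform of the power v^(-b). The shift by \<open>a\<close> contributes exp (- r a), so averaging
  over a law of \<open>a\<close> yields the transform of a convolution.\<close>

lemma nn_integral_shifted_powr_exp:
  fixes a b r :: real
  assumes b: "0 < b" "b < 1" and r: "0 < r"
  shows "(\<integral>\<^sup>+u. ennreal (exp (- (r * u))) * (ennreal (b / Gamma (1 - b) * (u - a) powr (- b)) * indicator {a<..} u) \<partial>lborel) =
         ennreal (b * r powr (b - 1)) * ennreal (exp (- (r * a)))"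
proof -
  have c: "Gamma (1 - b) > 0" using b by (simp add: Gamma_real_pos)
  have "(\<integral>\<^sup>+u. ennreal (exp (- (r * u))) * (ennreal (b / Gamma (1 - b) * (u - a) powr (- b)) * indicator {a<..} u) \<partial>lborel) =
    (\<integral>\<^sup>+v. ennreal (exp (- (r * (a + v)))) * (ennreal (b / Gamma (1 - b) * v powr (- b)) * indicator {0<..} v) \<partial>lborel)"
    by (subst nn_integral_real_affine[where c=1 and t=a]) (auto intro!: nn_integral_cong simp: indicator_def)
  also have "\<dots> = (\<integral>\<^sup>+v. ennreal (b / Gamma (1 - b) * exp (- (r * a))) *
       (ennreal (v powr ((1 - b) - 1) * exp (- (r * v))) * indicator {0<..} v) \<partial>lborel)"
    using b c
    by (intro nn_integral_cong)
       (auto simp: indicator_def ennreal_mult'[symmetric] ennreal_mult''[symmetric] exp_add[symmetric] distrib_left mult_ac)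
  also have "\<dots> = ennreal (b / Gamma (1 - b) * exp (- (r * a))) * ennreal (Gamma (1 - b) * r powr (- (1 - b)))"
    using b r by (subst nn_integral_cmult) (simp_all only: nn_integral_powr_exp diff_gt_0_iff_gt, auto)
  also have "\<dots> = ennreal (b * r powr (b - 1)) * ennreal (exp (- (r * a)))"
  proof -
    have "b / Gamma (1 - b) * exp (- (r * a)) * (Gamma (1 - b) * r powr (- (1 - b))) = b * r powr (b - 1) * exp (- (r * a))"
      using c by (simp add: less_imp_neq[symmetric])
    moreover have "ennreal (b / Gamma (1 - b) * exp (- (r * a))) * ennreal (Gamma (1 - b) * r powr (- (1 - b))) =
        ennreal (b / Gamma (1 - b) * exp (- (r * a)) * (Gamma (1 - b) * r powr (- (1 - b))))"
      by (rule ennreal_mult''[symmetric]) (use c in simp)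
    ultimately show ?thesis by (simp add: ennreal_mult'')
  qed
  finally show ?thesis .
qed

text \<open>The factor 1 / u is removed by writing exp (- s u) / u as the integral of exp (- r u)
  over r \<ge> s. After swapping, the transform of the convolution at r is b r^(b-1) exp (- r^b),
  minus the derivative of exp (- r^b), and integrating from s recovers the claim. No differentiation
  under the integral sign occurs.\<close>

lemma laplace_density_of_stable_law:
  fixes b :: real
  assumes b: "0 < b" "b < 1" and M: "real_distribution M"
    and L: "\<And>s. 0 \<le> s \<Longrightarrow> (LINT x|M. exp (- (s * max x 0))) = exp (- (s powr b))"
    and s: "0 < s"
  shows "(\<integral>\<^sup>+u\<in>{0<..}. ennreal (exp (- (s * u))) * (ennreal (1 / u) *
       (\<integral>\<^sup>+x. ennreal (b / Gamma (1 - b) * (u - max x 0) powr (- b)) * indicator {max x 0<..} u \<partial>M)) \<partial>lborel) =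
         ennreal (exp (- (s powr b)))"
proof -
  interpret real_distribution M by fact
  interpret P: pair_sigma_finite lborel M ..
  define k where "k u x = ennreal (b / Gamma (1 - b) * (u - max x 0) powr (- b)) * indicator {max x 0<..} u" for u x :: real
  have [measurable]: "case_prod k \<in> borel_measurable (borel \<Otimes>\<^sub>M borel)"
  proof -
    have "case_prod k = (\<lambda>(u, x). ennreal (b / Gamma (1 - b) * (u - max x 0) powr (- b)) * (if max x 0 < u then 1 else 0))"
      by (auto simp: k_def fun_eq_iff indicator_def)
    also have "\<dots> \<in> borel_measurable (borel \<Otimes>\<^sub>M borel)" by measurable
    finally show ?thesis .
  qed
  have "(\<integral>\<^sup>+u\<in>{0<..}. ennreal (exp (- (s * u))) * (ennreal (1 / u) * (\<integral>\<^sup>+x. k u x \<partial>M)) \<partial>lborel) =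
     (\<integral>\<^sup>+u. \<integral>\<^sup>+r. ennreal (exp (- (r * u))) * indicator {s..} r * (\<integral>\<^sup>+x. k u x \<partial>M) \<partial>lborel \<partial>lborel)"
  proof (rule nn_integral_cong)
    fix u :: real
    show "ennreal (exp (- (s * u))) * (ennreal (1 / u) * (\<integral>\<^sup>+x. k u x \<partial>M)) * indicator {0<..} u =
       (\<integral>\<^sup>+r. ennreal (exp (- (r * u))) * indicator {s..} r * (\<integral>\<^sup>+x. k u x \<partial>M) \<partial>lborel)"
    proof (cases "0 < u")
      case True
      have "ennreal (exp (- (s * u))) * (ennreal (1 / u) * (\<integral>\<^sup>+x. k u x \<partial>M)) =
             ennreal (exp (- (s * u)) / u) * (\<integral>\<^sup>+x. k u x \<partial>M)"
        by (simp add: mult.assoc[symmetric] ennreal_mult'[symmetric])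
      also have "\<dots> = (\<integral>\<^sup>+r. ennreal (exp (- (r * u))) * indicator {s..} r * (\<integral>\<^sup>+x. k u x \<partial>M) \<partial>lborel)"
        unfolding nn_integral_exp_atLeast[OF True, symmetric] by (rule nn_integral_multc[symmetric]) auto
      finally show ?thesis using True by simp
    next
      case False
      hence "k u x = 0" for x by (auto simp: k_def)
      thus ?thesis using False by simp
    qed
  qed
  also have "\<dots> = (\<integral>\<^sup>+r. \<integral>\<^sup>+u. ennreal (exp (- (r * u))) * indicator {s..} r * (\<integral>\<^sup>+x. k u x \<partial>M) \<partial>lborel \<partial>lborel)"
    by (rule lborel_pair.Fubini') measurable
  also have "\<dots> = (\<integral>\<^sup>+r. ennreal (b * r powr (b - 1) * exp (- (r powr b))) * indicator {s..} r \<partial>lborel)"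
  proof (rule nn_integral_cong)
    fix r :: real
    show "(\<integral>\<^sup>+u. ennreal (exp (- (r * u))) * indicator {s..} r * (\<integral>\<^sup>+x. k u x \<partial>M) \<partial>lborel) =
      ennreal (b * r powr (b - 1) * exp (- (r powr b))) * indicator {s..} r"
    proof (cases "s \<le> r")
      case True
      with s have r: "0 < r" by simp
      have "(\<integral>\<^sup>+u. ennreal (exp (- (r * u))) * indicator {s..} r * (\<integral>\<^sup>+x. k u x \<partial>M) \<partial>lborel) =
         (\<integral>\<^sup>+u. \<integral>\<^sup>+x. ennreal (exp (- (r * u))) * k u x \<partial>M \<partial>lborel)"
        using True by (intro nn_integral_cong) (auto intro!: nn_integral_cmult[symmetric])
      also have "\<dots> = (\<integral>\<^sup>+x. \<integral>\<^sup>+u. ennreal (exp (- (r * u))) * k u x \<partial>lborel \<partial>M)"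
        by (rule P.Fubini'[symmetric]) measurable
      also have "\<dots> = (\<integral>\<^sup>+x. ennreal (b * r powr (b - 1)) * ennreal (exp (- (r * max x 0))) \<partial>M)"
        unfolding k_def nn_integral_shifted_powr_exp[OF b r] ..
      also have "\<dots> = ennreal (b * r powr (b - 1)) * (\<integral>\<^sup>+x. ennreal (exp (- (r * max x 0))) \<partial>M)"
        by (rule nn_integral_cmult) auto
      also have "(\<integral>\<^sup>+x. ennreal (exp (- (r * max x 0))) \<partial>M) = ennreal (exp (- (r powr b)))"
      proof -
        have "integrable M (\<lambda>x. exp (- (r * max x 0)))"
          using r by (intro integrable_const_bound[where B=1]) auto
        thus ?thesis using r by (subst nn_integral_eq_integral) (auto simp: L)
      qed
      finally show ?thesis using True b by (simp add: ennreal_mult')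
    qed simp
  qed
  also have "\<dots> = ennreal (exp (- (s powr b)))"
    using b s by (intro nn_integral_powr_exp_atLeast) auto
  finally show ?thesis unfolding k_def .
qed

lemma exists_subord_density:
  fixes b :: real
  assumes b: "0 < b" "b < 1"
  shows "\<exists>g. g \<in> borel_measurable borel \<and> (\<forall>u. 0 \<le> g u) \<and>
      (\<forall>s\<ge>0. (\<integral>\<^sup>+u\<in>{0<..}. ennreal (exp (- s * u) * g u) \<partial>lborel) = ennreal (exp (- (s powr b))))"
proof -
  obtain M where M: "real_distribution M"
    and L: "\<And>s. 0 \<le> s \<Longrightarrow> (LINT x|M. exp (- (s * max x 0))) = exp (- (s powr b))"
    using exists_stable_law[OF b] by blast
  interpret real_distribution M by fact
  define H where "H u = ennreal (1 / u) * (\<integral>\<^sup>+x. ennreal (b / Gamma (1 - b) * (u - max x 0) powr (- b)) * indicator {max x 0<..} u \<partial>M)" for u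
  have [measurable]: "H \<in> borel_measurable borel"
    unfolding H_def indicator_def of_bool_def greaterThan_iff by measurable
  have H: "(\<integral>\<^sup>+u\<in>{0<..}. ennreal (exp (- (s * u))) * H u \<partial>lborel) = ennreal (exp (- (s powr b)))" if "0 < s" for s
    using laplace_density_of_stable_law[OF b M L that] unfolding H_def .
  \<comment> \<open>The finite transform at s = 1 shows that \<open>H\<close> is finite almost
    everywhere on the half-line, so passing to the real function \<open>enn2real (H u)\<close>
    changes no integral.\<close>
  have fin: "AE u in lborel. 0 < u \<longrightarrow> H u \<noteq> \<infinity>"
  proof -
    have "AE u in lborel. ennreal (exp (- (1 * u))) * H u * indicator {0<..} u \<noteq> \<infinity>"
      by (rule nn_integral_PInf_AE) (use H[of 1] in auto)
    thus ?thesis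
    proof eventually_elim
      case (elim u)
      show ?case
      proof (intro impI notI)
        assume "0 < u" "H u = \<infinity>"
        hence "ennreal (exp (- (1 * u))) * H u * indicator {0<..} u = \<infinity>"
          by (simp add: ennreal_mult_top)
        with elim show False by simp
      qed
    qed
  qed
  define g where "g u = enn2real (H u)" for u
  have g_meas [measurable]: "g \<in> borel_measurable borel"
    unfolding g_def by measurable
  have g_nonneg: "0 \<le> g u" for u by (simp add: g_def)
  have pos: "(\<integral>\<^sup>+u\<in>{0<..}. ennreal (exp (- s * u) * g u) \<partial>lborel) = ennreal (exp (- (s powr b)))" if "0 < s" for s
    unfolding H[OF that, symmetric]
    by (rule nn_integral_cong_AE, rule AE_mp[OF fin], rule AE_I2)
       (auto simp: g_def indicator_def ennreal_mult' less_top)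
  \<comment> \<open>The total mass, s = 0, comes by monotone convergence from s = 1 / (n + 1); here
    \<open>0 powr b\<close> is 0.\<close>
  have "(\<integral>\<^sup>+u\<in>{0<..}. ennreal (exp (- 0 * u) * g u) \<partial>lborel) = ennreal (exp (- (0 powr b)))"
  proof (rule LIMSEQ_unique)
    show "(\<lambda>n. \<integral>\<^sup>+u\<in>{0<..}. ennreal (exp (- inverse (real (Suc n)) * u) * g u) \<partial>lborel) \<longlonglongrightarrow>
       (\<integral>\<^sup>+u\<in>{0<..}. ennreal (exp (- 0 * u) * g u) \<partial>lborel)"
    proof (rule nn_integral_LIMSEQ)
      show "incseq (\<lambda>n u. ennreal (exp (- inverse (real (Suc n)) * u) * g u) * indicator {0<..} u)"
        unfolding incseq_def le_fun_def
        by (auto simp: indicator_def g_nonneg le_imp_inverse_le intro!: ennreal_leI mult_right_mono)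
      fix u
      have "(\<lambda>n. exp (- inverse (real (Suc n)) * u) * g u) \<longlonglongrightarrow> exp (- 0 * u) * g u"
        by (intro tendsto_intros LIMSEQ_inverse_real_of_nat)
      thus "(\<lambda>n. ennreal (exp (- inverse (real (Suc n)) * u) * g u) * indicator {0<..} u) \<longlonglongrightarrow>
          ennreal (exp (- 0 * u) * g u) * indicator {0<..} u"
        by (auto simp: indicator_def simp del: minus_zero mult_zero_left intro: tendsto_ennrealI)
    qed auto
    have "(\<lambda>n. ennreal (exp (- (inverse (real (Suc n)) powr b)))) \<longlonglongrightarrow> ennreal (exp (- 0))"
      using b by (intro tendsto_ennrealI tendsto_exp tendsto_minus tendsto_zero_powrI[OF LIMSEQ_inverse_real_of_nat tendsto_const]) auto
    thus "(\<lambda>n. \<integral>\<^sup>+u\<in>{0<..}. ennreal (exp (- inverse (real (Suc n)) * u) * g u) \<partial>lborel) \<longlonglongrightarrow>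
       ennreal (exp (- (0 powr b)))"
      by (subst pos) auto
  qed
  hence "(\<integral>\<^sup>+u\<in>{0<..}. ennreal (exp (- s * u) * g u) \<partial>lborel) = ennreal (exp (- (s powr b)))" if "0 \<le> s" for s
    using pos[of s] that by (cases "s = 0") auto
  thus ?thesis using g_meas g_nonneg by blast
qed

text \<open>Existence makes the choice operator in \<open>subord_density\<close> return a function
  with the specified properties. Everything later relies on these three facts only.\<close>

lemma
  assumes "0 < b" "b < 1"
  shows borel_measurable_subord_density: "subord_density b \<in> borel_measurable borel"
    and subord_density_nonneg: "0 \<le> subord_density b u"
    and laplace_subord_density: "0 \<le> s \<Longrightarrow>
      (\<integral>\<^sup>+u\<in>{0<..}. ennreal (exp (- s * u) * subord_density b u) \<partial>lborel) = ennreal (exp (- (s powr b)))"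
  using someI_ex[OF exists_subord_density[OF assms]] unfolding subord_density_def by blast+

section \<open>The symmetric stable density\<close>

lemma has_bochner_integral_iexp_gaussian:
  fixes a x :: real
  assumes a: "0 < a"
  shows "has_bochner_integral lborel (\<lambda>\<xi>. iexp (\<xi> * x) * of_real (exp (- a * \<xi>\<^sup>2)))
           (of_real (sqrt (pi / a) * exp (- x\<^sup>2 / (4 * a))))"
proof -
  \<comment> \<open>The substitution y = sqrt (2 a) \<xi> turns the standard normal density into the
    Gaussian with parameter \<open>a\<close>; its characteristic function is then needed at this
    \<open>t\<close>.\<close>
  define t where "t = x / sqrt (2 * a)"
  have "(CLINT y|std_normal_distribution. iexp (t * y)) = of_real (exp (- (t\<^sup>2) / 2))"
    using char_std_normal_distribution by (simp add: char_def fun_eq_iff)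
  hence I: "(CLINT y|lborel. std_normal_density y *\<^sub>R iexp (t * y)) = of_real (exp (- (t\<^sup>2) / 2))"
    by (subst (asm) integral_density) auto
  have int: "integrable lborel (\<lambda>y. std_normal_density y *\<^sub>R iexp (t * y))"
  proof (rule Bochner_Integration.integrable_bound)
    show "integrable lborel std_normal_density" by simp
    show "AE y in lborel. norm (std_normal_density y *\<^sub>R iexp (t * y)) \<le> norm (std_normal_density y)"
      by auto
  qed auto
  have "has_bochner_integral lborel (\<lambda>y. std_normal_density y *\<^sub>R iexp (t * y)) (of_real (exp (- (t\<^sup>2) / 2)))"
    using int I by (simp add: has_bochner_integral_iff)
  hence "has_bochner_integral lborel (\<lambda>\<xi>. std_normal_density (0 + sqrt (2 * a) * \<xi>) *\<^sub>R iexp (t * (0 + sqrt (2 * a) * \<xi>)))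
           (of_real (exp (- (t\<^sup>2) / 2)) /\<^sub>R \<bar>sqrt (2 * a)\<bar>)"
    by (rule lborel_has_bochner_integral_real_affine_iff[THEN iffD1, rotated]) (use a in simp)
  hence "has_bochner_integral lborel (\<lambda>\<xi>. complex_of_real (sqrt (2 * pi)) * (std_normal_density (0 + sqrt (2 * a) * \<xi>) *\<^sub>R iexp (t * (0 + sqrt (2 * a) * \<xi>))))
           (complex_of_real (sqrt (2 * pi)) * (of_real (exp (- (t\<^sup>2) / 2)) /\<^sub>R \<bar>sqrt (2 * a)\<bar>))"
    by (rule has_bochner_integral_mult_right)
  also have "(\<lambda>\<xi>. complex_of_real (sqrt (2 * pi)) * (std_normal_density (0 + sqrt (2 * a) * \<xi>) *\<^sub>R iexp (t * (0 + sqrt (2 * a) * \<xi>)))) =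
      (\<lambda>\<xi>. iexp (\<xi> * x) * of_real (exp (- a * \<xi>\<^sup>2)))"
  proof
    fix \<xi>
    have 1: "t * (sqrt (2 * a) * \<xi>) = \<xi> * x"
      using a by (simp add: t_def)
    have 2: "sqrt (2 * pi) * std_normal_density (sqrt (2 * a) * \<xi>) = exp (- a * \<xi>\<^sup>2)"
      using a by (simp add: std_normal_density_def power_mult_distrib)
    have "complex_of_real (sqrt (2 * pi)) * (std_normal_density (sqrt (2 * a) * \<xi>) *\<^sub>R iexp (\<xi> * x)) =
      complex_of_real (sqrt (2 * pi) * std_normal_density (sqrt (2 * a) * \<xi>)) * iexp (\<xi> * x)"
      by (simp only: scaleR_conv_of_real of_real_mult mult.assoc)
    thus "complex_of_real (sqrt (2 * pi)) * (std_normal_density (0 + sqrt (2 * a) * \<xi>) *\<^sub>R iexp (t * (0 + sqrt (2 * a) * \<xi>))) =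
      iexp (\<xi> * x) * of_real (exp (- a * \<xi>\<^sup>2))"
      unfolding add_0_left 1 2 by (simp add: mult.commute)
  qed
  also have "complex_of_real (sqrt (2 * pi)) * (of_real (exp (- (t\<^sup>2) / 2)) /\<^sub>R \<bar>sqrt (2 * a)\<bar>) =
      of_real (sqrt (2 * pi) / sqrt (2 * a) * exp (- (t\<^sup>2) / 2))"
    using a by (simp add: scaleR_conv_of_real field_simps)
  also have "sqrt (2 * pi) / sqrt (2 * a) = sqrt (pi / a)"
    by (simp add: real_sqrt_divide[symmetric])
  also have "t\<^sup>2 / 2 = x\<^sup>2 / (4 * a)"
    using a by (simp add: t_def power_divide)
  hence "- (t\<^sup>2) / 2 = - x\<^sup>2 / (4 * a)" by simp
  finally show ?thesis .
qed

text \<open>Lebesgue measure on the space is the image of the product measure over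
  \<open>Basis\<close> under the coordinate sum, so integrals of products of one-coordinate
  functions factor.\<close>

lemma has_bochner_integral_lborel_prod:
  fixes f :: "'a::euclidean_space \<Rightarrow> real \<Rightarrow> complex"
  assumes "\<And>b. b \<in> Basis \<Longrightarrow> has_bochner_integral lborel (f b) (I b)"
  shows "has_bochner_integral lborel (\<lambda>x. \<Prod>b\<in>Basis. f b (x \<bullet> b)) (\<Prod>b\<in>Basis. I b)"
proof -
  interpret product_sigma_finite "\<lambda>_::'a. lborel :: real measure" ..
  have f: "integrable lborel (f b)" "integral\<^sup>L lborel (f b) = I b" if "b \<in> Basis" for b
    using assms[OF that] by (auto simp: has_bochner_integral_iff)
  hence [measurable]: "f b \<in> borel_measurable borel" if "b \<in> Basis" for b
    using that borel_measurable_integrable by fastforce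
  have "integrable (\<Pi>\<^sub>M b\<in>Basis. lborel) (\<lambda>y. \<Prod>b\<in>Basis. f b (y b))"
    by (intro product_integrable_prod f) auto
  moreover have "(\<integral>y. (\<Prod>b\<in>Basis. f b (y b)) \<partial>(\<Pi>\<^sub>M b\<in>Basis. lborel)) = (\<Prod>b\<in>Basis. I b)"
    using f by (subst product_integral_prod) auto
  ultimately have "has_bochner_integral (\<Pi>\<^sub>M b\<in>Basis. lborel) (\<lambda>y. \<Prod>b\<in>Basis. f b (y b)) (\<Prod>b\<in>Basis. I b)"
    by (simp add: has_bochner_integral_iff)
  also have "(\<lambda>y. \<Prod>b\<in>Basis. f b (y b)) = (\<lambda>y. \<Prod>b\<in>Basis. f b ((\<Sum>c\<in>Basis. y c *\<^sub>R c) \<bullet> b))"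
    by (auto simp: fun_eq_iff inner_sum_left inner_Basis if_distrib cong: if_cong intro!: prod.cong)
  finally show ?thesis
    by (subst lborel_eq, intro has_bochner_integral_distr) measurable
qed

text \<open>The cosine of an inner product does not factor over coordinates but the complex
  exponential does. The product formula is applied to the latter and the real part is taken at the
  end.\<close>

lemma has_bochner_integral_cos_gaussian:
  fixes x :: "'a::euclidean_space"
  assumes a: "0 < a"
  shows "has_bochner_integral lborel (\<lambda>\<xi>::'a. cos (\<xi> \<bullet> x) * exp (- a * (norm \<xi>)\<^sup>2))
           (sqrt (pi / a) ^ DIM('a) * exp (- (norm x)\<^sup>2 / (4 * a)))"
proof -
  have n2: "(norm y)\<^sup>2 = (\<Sum>b\<in>Basis. (y \<bullet> b)\<^sup>2)" for y :: 'a
    by (subst power2_norm_eq_inner, subst euclidean_inner) (simp add: power2_eq_square)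
  have "has_bochner_integral lborel (\<lambda>\<xi>::'a. \<Prod>b\<in>Basis. iexp ((\<xi> \<bullet> b) * (x \<bullet> b)) * of_real (exp (- a * (\<xi> \<bullet> b)\<^sup>2)))
     (\<Prod>b\<in>(Basis::'a set). of_real (sqrt (pi / a) * exp (- (x \<bullet> b)\<^sup>2 / (4 * a))))"
    by (rule has_bochner_integral_lborel_prod) (rule has_bochner_integral_iexp_gaussian[OF a])
  also have "(\<lambda>\<xi>::'a. \<Prod>b\<in>Basis. iexp ((\<xi> \<bullet> b) * (x \<bullet> b)) * of_real (exp (- a * (\<xi> \<bullet> b)\<^sup>2))) =
      (\<lambda>\<xi>. iexp (\<xi> \<bullet> x) * of_real (exp (- a * (norm \<xi>)\<^sup>2)))"
  proof
    fix \<xi> :: 'a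
    have "(\<Prod>b\<in>Basis. iexp ((\<xi> \<bullet> b) * (x \<bullet> b))) = iexp (\<xi> \<bullet> x)"
      by (subst euclidean_inner) (simp add: exp_sum sum_distrib_left)
    moreover have "(\<Prod>b\<in>Basis. exp (- a * (\<xi> \<bullet> b)\<^sup>2)) = exp (- a * (norm \<xi>)\<^sup>2)"
      unfolding n2 by (simp add: exp_sum sum_distrib_left sum_negf[symmetric])
    ultimately show "(\<Prod>b\<in>Basis. iexp ((\<xi> \<bullet> b) * (x \<bullet> b)) * of_real (exp (- a * (\<xi> \<bullet> b)\<^sup>2))) =
      iexp (\<xi> \<bullet> x) * of_real (exp (- a * (norm \<xi>)\<^sup>2))"
      by (simp only: prod.distrib of_real_prod[symmetric])
  qed
  also have "(\<Prod>b\<in>(Basis::'a set). complex_of_real (sqrt (pi / a) * exp (- (x \<bullet> b)\<^sup>2 / (4 * a)))) =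
      complex_of_real (sqrt (pi / a) ^ DIM('a) * exp (- (norm x)\<^sup>2 / (4 * a)))"
    unfolding n2
    by (simp add: of_real_prod[symmetric] prod.distrib exp_sum sum_divide_distrib sum_negf[symmetric] del: of_real_prod)
  finally have "has_bochner_integral lborel (\<lambda>\<xi>. Re (iexp (\<xi> \<bullet> x) * of_real (exp (- a * (norm \<xi>)\<^sup>2))))
      (Re (complex_of_real (sqrt (pi / a) ^ DIM('a) * exp (- (norm x)\<^sup>2 / (4 * a)))))"
    by (rule has_bochner_integral_bounded_linear[OF bounded_linear_Re])
  thus ?thesis by (simp add: Re_exp)
qed

section \<open>Subordination: the stable density as a mixture of heat kernels\<close>

lemma nn_integral_stretched_exp_finite:
  fixes a c :: real
  assumes "0 < a" "0 < c"
  shows "(\<integral>\<^sup>+y. ennreal (exp (- c * \<bar>y\<bar> powr a)) \<partial>lborel) < \<infinity>"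
proof -
  have "eventually (\<lambda>y::real. exp (- c * y powr a) \<le> y powr (- 2)) at_top"
    using assms by real_asymp
  then obtain R0 where R0: "\<And>y. y \<ge> R0 \<Longrightarrow> exp (- c * y powr a) \<le> y powr (- 2)"
    by (auto simp: eventually_at_top_linorder)
  define R where "R = max R0 1"
  have R: "R > 0" by (simp add: R_def)
  have tail: "(\<integral>\<^sup>+y. ennreal (y powr (- 2)) * indicator {R..} y \<partial>lborel) = ennreal (1 / R)"
    using R nn_integral_has_integral_lebesgue'[OF _ has_integral_powr_to_inf[of "- 2" R]]
    by (simp add: powr_minus_divide)
  have tail': "(\<integral>\<^sup>+y. ennreal ((- y) powr (- 2)) * indicator {R..} (- y) \<partial>lborel) = ennreal (1 / R)"
    using tail by (subst (asm) nn_integral_real_affine[where c="- 1" and t=0]) auto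
  have "(\<integral>\<^sup>+y. ennreal (exp (- c * \<bar>y\<bar> powr a)) \<partial>lborel) \<le>
     (\<integral>\<^sup>+y. indicator {-R..R} y + (ennreal (y powr (- 2)) * indicator {R..} y + ennreal ((- y) powr (- 2)) * indicator {R..} (- y)) \<partial>lborel)"
  proof (rule nn_integral_mono)
    fix y :: real
    consider "\<bar>y\<bar> \<le> R" | "y > R" | "y < - R" by linarith
    thus "ennreal (exp (- c * \<bar>y\<bar> powr a)) \<le> indicator {-R..R} y + (ennreal (y powr (- 2)) * indicator {R..} y + ennreal ((- y) powr (- 2)) * indicator {R..} (- y))"
    proof cases
      case 1
      have "ennreal (exp (- c * \<bar>y\<bar> powr a)) \<le> 1"
        using assms by simp
      also have "1 \<le> indicator {-R..R} y + (ennreal (y powr (- 2)) * indicator {R..} y + ennreal ((- y) powr (- 2)) * indicator {R..} (- y))"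
        using 1 by (intro add_increasing2) (auto simp: indicator_def)
      finally show ?thesis .
    next
      case 2
      with R R0[of y] show ?thesis by (auto simp: R_def indicator_def intro!: ennreal_leI)
    next
      case 3
      with R R0[of "- y"] show ?thesis by (auto simp: R_def indicator_def intro!: ennreal_leI)
    qed
  qed
  also have "\<dots> = emeasure lborel {-R..R} + (ennreal (1 / R) + ennreal (1 / R))"
    unfolding tail[symmetric]
    by (subst nn_integral_add, simp, simp, subst nn_integral_add, simp, simp, unfold tail tail', simp)
  also have "\<dots> < \<infinity>"
    using R by simp
  finally show ?thesis .
qed

lemma nn_integral_stretched_exp_norm_finite:
  assumes "0 < a" "0 < t"
  shows "(\<integral>\<^sup>+\<xi>. ennreal (exp (- t * norm (\<xi>::'a::euclidean_space) powr a)) \<partial>lborel) < \<infinity>"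
proof -
  \<comment> \<open>Every coordinate is bounded by the norm, so sharing \<open>t\<close> equally
    among the d coordinates gives a sum of at most t |\<xi>|^a. The integrand is thereby dominated
    by a product of one-dimensional ones.\<close>
  define c where "c = t / real DIM('a)"
  have c: "c > 0" using assms by (simp add: c_def)
  have "(\<integral>\<^sup>+\<xi>. ennreal (exp (- t * norm (\<xi>::'a) powr a)) \<partial>lborel) \<le>
    (\<integral>\<^sup>+(\<xi>::'a). (\<Prod>b\<in>Basis. ennreal (exp (- c * \<bar>\<xi> \<bullet> b\<bar> powr a))) \<partial>lborel)"
  proof (rule nn_integral_mono)
    fix \<xi> :: 'a
    have "c * (\<Sum>b\<in>Basis. \<bar>\<xi> \<bullet> b\<bar> powr a) \<le> c * (\<Sum>b\<in>(Basis::'a set). norm \<xi> powr a)"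
      using assms c by (intro mult_left_mono sum_mono powr_mono2) (auto simp: Basis_le_norm)
    also have "\<dots> = t * norm \<xi> powr a"
      by (simp add: c_def)
    finally have "exp (- t * norm \<xi> powr a) \<le> exp (- c * (\<Sum>b\<in>Basis. \<bar>\<xi> \<bullet> b\<bar> powr a))"
      by simp
    also have "\<dots> = (\<Prod>b\<in>Basis. exp (- c * \<bar>\<xi> \<bullet> b\<bar> powr a))"
      by (subst exp_sum[symmetric]) (auto simp: sum_distrib_left)
    finally show "ennreal (exp (- t * norm \<xi> powr a)) \<le> (\<Prod>b\<in>Basis. ennreal (exp (- c * \<bar>\<xi> \<bullet> b\<bar> powr a)))"
      by (subst prod_ennreal) (auto intro!: ennreal_leI)
  qed
  also have "\<dots> = (\<Prod>b\<in>(Basis::'a set). (\<integral>\<^sup>+y. ennreal (exp (- c * \<bar>y\<bar> powr a)) \<partial>lborel))"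
    by (rule nn_integral_lborel_prod) auto
  also have "\<dots> < \<infinity>"
    using nn_integral_stretched_exp_finite[OF assms(1) c] by (simp add: power_less_top_ennreal)
  finally show ?thesis .
qed

text \<open>Normalized for the full Laplacian: the Fourier transform at time \<open>y\<close> is exp
  (- y |\<xi>|^2).\<close>

definition heat_kernel :: "real \<Rightarrow> 'a::euclidean_space \<Rightarrow> real" where
  "heat_kernel y z = (1 / sqrt (4 * pi * y)) ^ DIM('a) * exp (- (norm z)\<^sup>2 / (4 * y))"

lemma borel_measurable_heat_kernel [measurable (raw)]:
  assumes [measurable]: "f \<in> borel_measurable M"
  shows "(\<lambda>w. heat_kernel (f w) z) \<in> borel_measurable M"
  unfolding heat_kernel_def by measurable

text \<open>exp (- t |\<xi>|^\<alpha>) is the Laplace transform of the \<alpha>/2-stable density at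
  t^(2/\<alpha>) |\<xi>|^2. Inserting this into the inversion integral and swapping leaves a
  Gaussian to invert for each u. This representation makes visible the positivity that the cosine
  integral hides.\<close>

lemma stable_density_subordination:
  fixes x :: "'a::euclidean_space"
  assumes \<alpha>: "0 < \<alpha>" "\<alpha> < 2" and t: "0 < t"
  shows "has_bochner_integral lborel
    (\<lambda>u. indicator {0<..} u * (heat_kernel (t powr (2 / \<alpha>) * u) x * subord_density (\<alpha> / 2) u))
    (stable_density \<alpha> t x)"
proof -
  define c where "c = t powr (2 / \<alpha>)"
  have c: "c > 0" using t by (simp add: c_def)
  define g where "g = subord_density (\<alpha> / 2)"
  have [measurable]: "g \<in> borel_measurable borel"
    unfolding g_def using \<alpha> by (intro borel_measurable_subord_density) auto
  have g_nonneg: "0 \<le> g u" for u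
    unfolding g_def using \<alpha> by (intro subord_density_nonneg) auto
  define k where "k \<xi> u = exp (- (c * u) * (norm \<xi>)\<^sup>2) * g u * indicator {0<..} u" for \<xi> :: 'a and u :: real
  have k_nonneg: "0 \<le> k \<xi> u" for \<xi> u
    by (simp add: k_def g_nonneg)
  have [measurable]: "case_prod k \<in> borel_measurable (borel \<Otimes>\<^sub>M borel)"
    unfolding k_def by measurable
  have k_nn: "(\<integral>\<^sup>+u. ennreal (k \<xi> u) \<partial>lborel) = ennreal (exp (- t * norm \<xi> powr \<alpha>))" for \<xi>
  proof -
    have "(c * (norm \<xi>)\<^sup>2) powr (\<alpha> / 2) = t * norm \<xi> powr \<alpha>"
    proof (cases "\<xi> = 0")
      case False
      have "(norm \<xi>)\<^sup>2 powr (\<alpha> / 2) = (norm \<xi> powr 2) powr (\<alpha> / 2)"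
        using False by simp
      also have "\<dots> = norm \<xi> powr \<alpha>"
        by (simp only: powr_powr) simp
      finally show ?thesis using \<alpha> t by (simp add: c_def powr_mult powr_powr)
    qed (use \<alpha> in simp)
    moreover have "(\<integral>\<^sup>+u. ennreal (k \<xi> u) \<partial>lborel) = (\<integral>\<^sup>+u\<in>{0<..}. ennreal (exp (- (c * (norm \<xi>)\<^sup>2) * u) * g u) \<partial>lborel)"
      by (intro nn_integral_cong) (auto simp: k_def indicator_def mult_ac)
    ultimately show ?thesis
      using laplace_subord_density[of "\<alpha> / 2" "c * (norm \<xi>)\<^sup>2"] \<alpha> c by (simp add: g_def)
  qed
  have k_int: "has_bochner_integral lborel (k \<xi>) (exp (- t * norm \<xi> powr \<alpha>))" for \<xi>
    by (rule has_bochner_integral_nn_integral) (auto simp: k_nonneg k_nn)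
  define f where "f \<xi> u = cos (\<xi> \<bullet> x) * k \<xi> u" for \<xi> u
  have [measurable]: "case_prod f \<in> borel_measurable (borel \<Otimes>\<^sub>M borel)"
    unfolding f_def by measurable
  \<comment> \<open>Joint integrability for Fubini: the cosine is bounded by 1, and integrating
    \<open>k\<close> over u first leaves a stretched exponential in \<xi>.\<close>
  have f_int: "integrable (lborel \<Otimes>\<^sub>M lborel) (case_prod f)"
  proof (rule integrableI_bounded)
    have "(\<integral>\<^sup>+z. ennreal (norm (case_prod f z)) \<partial>(lborel \<Otimes>\<^sub>M lborel)) =
            (\<integral>\<^sup>+\<xi>. \<integral>\<^sup>+u. ennreal (norm (f \<xi> u)) \<partial>lborel \<partial>lborel)"
      by (subst lborel.nn_integral_fst[symmetric]) auto
    also have "\<dots> \<le> (\<integral>\<^sup>+\<xi>. \<integral>\<^sup>+u. ennreal (k \<xi> u) \<partial>lborel \<partial>lborel)"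
      by (intro nn_integral_mono ennreal_leI) (auto simp: f_def abs_mult k_nonneg intro!: mult_left_le_one_le)
    also have "\<dots> < \<infinity>"
      unfolding k_nn by (rule nn_integral_stretched_exp_norm_finite) fact+
    finally show "(\<integral>\<^sup>+z. ennreal (norm (case_prod f z)) \<partial>(lborel \<Otimes>\<^sub>M lborel)) < \<infinity>" .
  qed simp
  have inner1: "(\<integral>u. f \<xi> u \<partial>lborel) = cos (\<xi> \<bullet> x) * exp (- t * norm \<xi> powr \<alpha>)" for \<xi>
    unfolding f_def using k_int[of \<xi>] by (simp add: has_bochner_integral_iff)
  have inner2: "(\<integral>\<xi>. f \<xi> u \<partial>lborel) = indicator {0<..} u * ((2 * pi) ^ DIM('a) * heat_kernel (c * u) x * g u)" for u
  proof (cases "u > 0")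
    case True
    have "f \<xi> u = cos (\<xi> \<bullet> x) * exp (- (c * u) * (norm \<xi>)\<^sup>2) * g u" for \<xi>
      using True by (simp add: f_def k_def)
    moreover have "has_bochner_integral lborel (\<lambda>\<xi>. cos (\<xi> \<bullet> x) * exp (- (c * u) * (norm \<xi>)\<^sup>2))
        (sqrt (pi / (c * u)) ^ DIM('a) * exp (- (norm x)\<^sup>2 / (4 * (c * u))))"
      using c True by (intro has_bochner_integral_cos_gaussian) simp
    ultimately have "(\<integral>\<xi>. f \<xi> u \<partial>lborel) = sqrt (pi / (c * u)) ^ DIM('a) * exp (- (norm x)\<^sup>2 / (4 * (c * u))) * g u"
      by (simp add: has_bochner_integral_iff)
    moreover have "sqrt (pi / (c * u)) = (2 * pi) * (1 / sqrt (4 * pi * (c * u)))"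
    proof -
      have "pi / (c * u) = (2 * pi)\<^sup>2 / (4 * pi * (c * u))"
        by (simp add: power2_eq_square field_simps)
      hence "sqrt (pi / (c * u)) = sqrt ((2 * pi)\<^sup>2) / sqrt (4 * pi * (c * u))"
        by (simp only: real_sqrt_divide)
      thus ?thesis by (simp only: real_sqrt_abs) simp
    qed
    ultimately show ?thesis
      using True by (simp only: heat_kernel_def power_mult_distrib) simp
  qed (simp add: f_def k_def)
  have "has_bochner_integral lborel (\<lambda>u. \<integral>\<xi>. f \<xi> u \<partial>lborel) (\<integral>u. \<integral>\<xi>. f \<xi> u \<partial>lborel \<partial>lborel)"
    using lborel_pair.integrable_snd[OF f_int] by (simp add: has_bochner_integral_iff)
  also have "(\<integral>u. \<integral>\<xi>. f \<xi> u \<partial>lborel \<partial>lborel) = (\<integral>\<xi>. \<integral>u. f \<xi> u \<partial>lborel \<partial>lborel)"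
    by (rule lborel_pair.Fubini_integral[OF f_int])
  also have "\<dots> = (\<integral>\<xi>. cos (\<xi> \<bullet> x) * exp (- t * norm \<xi> powr \<alpha>) \<partial>lborel)"
    by (simp only: inner1)
  finally have "has_bochner_integral lborel (\<lambda>u. (1 / (2 * pi) ^ DIM('a)) * (\<integral>\<xi>. f \<xi> u \<partial>lborel)) (stable_density \<alpha> t x)"
    unfolding stable_density_def by (rule has_bochner_integral_mult_right)
  thus ?thesis
    unfolding inner2 c_def g_def by (simp add: mult_ac)
qed

section \<open>Pointwise bounds on the stable density\<close>

lemma power_mult_exp_neg_square_le:
  fixes v :: real
  assumes "0 \<le> v"
  shows "v ^ n * exp (- v\<^sup>2) \<le> exp (real n ^ 2)"
proof -
  have "v \<le> exp v"
    using exp_ge_add_one_self[of v] by linarith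
  hence "v ^ n \<le> exp v ^ n"
    using assms by (intro power_mono) auto
  hence "v ^ n * exp (- v\<^sup>2) \<le> exp (real n * v) * exp (- v\<^sup>2)"
    by (intro mult_right_mono) (auto simp: exp_of_nat_mult)
  also have "\<dots> = exp (real n * v - v\<^sup>2)"
    by (simp add: exp_diff exp_minus divide_inverse)
  also have "\<dots> \<le> exp (real n ^ 2)"
  proof -
    have "0 \<le> (real n - v) ^ 2 + real n * v"
      using assms by simp
    thus ?thesis by (simp add: power2_eq_square algebra_simps)
  qed
  finally show ?thesis .
qed

lemma heat_kernel_nonneg: "0 \<le> y \<Longrightarrow> 0 \<le> heat_kernel y z"
  unfolding heat_kernel_def by simp

text \<open>In terms of v = |z| / sqrt (4 y) the kernel is |z|^(-d) times a constant multiple of v^d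
  exp (- v^2), which is bounded in v. The bound is thus uniform in time; at z = 0 the kernel blows
  up as y tends to 0.\<close>

lemma heat_kernel_le:
  fixes z :: "'a::euclidean_space"
  assumes y: "0 < y" and z: "z \<noteq> 0"
  shows "heat_kernel y z \<le> exp (real DIM('a) ^ 2) / norm z ^ DIM('a)"
proof -
  define v where "v = norm z / sqrt (4 * y)"
  have v: "v \<ge> 0" "v\<^sup>2 = (norm z)\<^sup>2 / (4 * y)"
    using y by (auto simp: v_def power_divide)
  have "1 / sqrt (4 * pi * y) = 1 / sqrt pi * (v / norm z)"
    using y z by (simp add: v_def real_sqrt_mult)
  hence "heat_kernel y z = (1 / sqrt pi) ^ DIM('a) * (v ^ DIM('a) * exp (- v\<^sup>2)) / norm z ^ DIM('a)"
    unfolding heat_kernel_def v(2) by (simp add: power_mult_distrib power_divide)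
  also have "\<dots> \<le> 1 * exp (real DIM('a) ^ 2) / norm z ^ DIM('a)"
    using v(1) pi_gt3
    by (intro divide_right_mono mult_mono power_mult_exp_neg_square_le power_le_one) auto
  finally show ?thesis by simp
qed

lemma nn_integral_subord_density:
  assumes "0 < b" "b < 1"
  shows "(\<integral>\<^sup>+u\<in>{0<..}. ennreal (subord_density b u) \<partial>lborel) = 1"
  using laplace_subord_density[OF assms, of 0] by simp

lemma has_bochner_integral_subord_density:
  assumes "0 < b" "b < 1"
  shows "has_bochner_integral lborel (\<lambda>u. indicator {0<..} u * subord_density b u) 1"
proof (rule has_bochner_integral_nn_integral)
  show "(\<lambda>u. indicator {0<..} u * subord_density b u) \<in> borel_measurable lborel"
    using borel_measurable_subord_density[OF assms] by simp
  have "(\<integral>\<^sup>+u. ennreal (indicator {0<..} u * subord_density b u) \<partial>lborel) =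
      (\<integral>\<^sup>+u\<in>{0<..}. ennreal (subord_density b u) \<partial>lborel)"
    by (intro nn_integral_cong) (auto simp: indicator_def)
  thus "(\<integral>\<^sup>+u. ennreal (indicator {0<..} u * subord_density b u) \<partial>lborel) = ennreal 1"
    using nn_integral_subord_density[OF assms] by simp
qed (use subord_density_nonneg[OF assms] in auto)

lemma stable_density_nonneg:
  assumes \<alpha>: "0 < \<alpha>" "\<alpha> < 2" and t: "0 < t"
  shows "0 \<le> stable_density \<alpha> t x"
proof -
  have "0 \<le> (\<integral>u. indicator {0<..} u * (heat_kernel (t powr (2 / \<alpha>) * u) x * subord_density (\<alpha> / 2) u) \<partial>lborel)"
    using \<alpha> by (intro Bochner_Integration.integral_nonneg)
      (auto simp: indicator_def intro!: mult_nonneg_nonneg heat_kernel_nonneg subord_density_nonneg)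
  thus ?thesis
    using stable_density_subordination[OF assms, of x] by (simp add: has_bochner_integral_iff)
qed

text \<open>Serves as a dominating function: being uniform in \<open>t\<close>, it makes the
  integrand of \<open>Gkernel\<close> integrable in u away from the origin. A Bochner integral of a
  non-integrable function would default to 0 and no lower bound would follow.\<close>

lemma stable_density_le:
  fixes x :: "'a::euclidean_space"
  assumes \<alpha>: "0 < \<alpha>" "\<alpha> < 2" and t: "0 < t" and x: "x \<noteq> 0"
  shows "stable_density \<alpha> t x \<le> exp (real DIM('a) ^ 2) / norm x ^ DIM('a)"
proof -
  let ?C = "exp (real DIM('a) ^ 2) / norm x ^ DIM('a)"
  have "(\<integral>u. indicator {0<..} u * (heat_kernel (t powr (2 / \<alpha>) * u) x * subord_density (\<alpha> / 2) u) \<partial>lborel) \<le>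
     (\<integral>u. ?C * (indicator {0<..} u * subord_density (\<alpha> / 2) u) \<partial>lborel)"
  proof (rule Bochner_Integration.integral_mono)
    show "integrable lborel (\<lambda>u. indicator {0<..} u * (heat_kernel (t powr (2 / \<alpha>) * u) x * subord_density (\<alpha> / 2) u))"
      using stable_density_subordination[OF \<alpha> t, of x] by (simp add: has_bochner_integral_iff)
    show "integrable lborel (\<lambda>u. ?C * (indicator {0<..} u * subord_density (\<alpha> / 2) u))"
      using has_bochner_integral_subord_density[of "\<alpha> / 2"] \<alpha> by (simp add: has_bochner_integral_iff)
    fix u :: real
    show "indicator {0<..} u * (heat_kernel (t powr (2 / \<alpha>) * u) x * subord_density (\<alpha> / 2) u) \<le>
        ?C * (indicator {0<..} u * subord_density (\<alpha> / 2) u)"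
    proof (cases "u > 0")
      case True
      have "heat_kernel (t powr (2 / \<alpha>) * u) x * subord_density (\<alpha> / 2) u \<le> ?C * subord_density (\<alpha> / 2) u"
        using \<alpha> t x True by (intro mult_right_mono heat_kernel_le subord_density_nonneg) auto
      thus ?thesis using True by simp
    qed simp
  qed
  also have "\<dots> = ?C"
    using has_bochner_integral_subord_density[of "\<alpha> / 2"] \<alpha> by (simp add: has_bochner_integral_iff)
  finally show ?thesis
    using stable_density_subordination[OF \<alpha> t, of x] by (simp add: has_bochner_integral_iff)
qed

text \<open>The intervals [1/(n+2), n+2] exhaust the half-line, whose total mass is 1, so one of
  them has positive mass. Lower bounds for subordinated kernels keep only this compact range, on
  which u is comparable to a constant.\<close>

lemma subord_density_mass:
  assumes "0 < b" "b < 1"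
  obtains p q m where "0 < p" "p < q" "0 < m"
    "has_bochner_integral lborel (\<lambda>u. indicator {p..q} u * subord_density b u) m"
proof -
  let ?g = "subord_density b"
  have [measurable]: "?g \<in> borel_measurable borel"
    using assms by (rule borel_measurable_subord_density)
  define p q :: "nat \<Rightarrow> real" where "p n = 1 / (real n + 2)" and "q n = real n + 2" for n
  have pq: "0 < p n" "p n < q n" for n
    by (auto simp: p_def q_def divide_less_eq intro!: less_1_mult)
  have "\<exists>n. (\<integral>\<^sup>+u. ennreal (indicator {p n..q n} u * ?g u) \<partial>lborel) \<noteq> 0"
  proof (rule ccontr)
    assume "\<not> ?thesis"
    hence "AE u in lborel. ennreal (indicator {p n..q n} u * ?g u) = 0" for n
      by (subst nn_integral_0_iff_AE[symmetric]) auto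
    hence "AE u in lborel. \<forall>n. ennreal (indicator {p n..q n} u * ?g u) = 0"
      by (simp add: AE_all_countable)
    hence "AE u in lborel. ennreal (?g u) * indicator {0<..} u = 0"
    proof eventually_elim
      case (elim u)
      show ?case
      proof (cases "u > 0")
        case True
        obtain n where n: "max u (1 / u) < real n" using reals_Archimedean2 by blast
        hence "p n \<le> u" "u \<le> q n"
          using True by (auto simp: p_def q_def field_simps)
        with elim[rule_format, of n] show ?thesis by simp
      qed simp
    qed
    hence "(\<integral>\<^sup>+u\<in>{0<..}. ennreal (?g u) \<partial>lborel) = 0"
      by (subst nn_integral_0_iff_AE) auto
    thus False using nn_integral_subord_density[OF assms] by simp
  qed
  then obtain n where n: "(\<integral>\<^sup>+u. ennreal (indicator {p n..q n} u * ?g u) \<partial>lborel) \<noteq> 0" ..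
  have int: "integrable lborel (\<lambda>u. indicator {p n..q n} u * ?g u)"
  proof (rule Bochner_Integration.integrable_bound)
    show "integrable lborel (\<lambda>u. indicator {0<..} u * ?g u)"
      using has_bochner_integral_subord_density[OF assms] by (simp add: has_bochner_integral_iff)
    show "AE u in lborel. norm (indicator {p n..q n} u * ?g u) \<le> norm (indicator {0<..} u * ?g u)"
      using pq(1)[of n] by (auto simp: indicator_def)
  qed simp
  have nn: "0 \<le> indicator {p n..q n} u * ?g u" for u
    using subord_density_nonneg[OF assms] by simp
  have "(\<integral>\<^sup>+u. ennreal (indicator {p n..q n} u * ?g u) \<partial>lborel) = ennreal (\<integral>u. indicator {p n..q n} u * ?g u \<partial>lborel)"
    using int nn by (intro nn_integral_eq_integral) auto
  with n have "0 < (\<integral>u. indicator {p n..q n} u * ?g u \<partial>lborel)"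
    by (metis ennreal_eq_0_iff not_less)
  thus ?thesis
    using int that[OF pq[of n]] by (auto simp: has_bochner_integral_iff)
qed

text \<open>Only u in [p, q] is kept in the subordination formula. There the prefactor of the heat
  kernel is smallest at u = q and its exponential is smallest at u = p, which gives a lower bound
  with the correct scaling in \<open>t\<close>.\<close>

lemma stable_density_lower:
  assumes \<alpha>: "0 < \<alpha>" "\<alpha> < 2"
  obtains A B where "0 < A" "0 < B"
    "\<And>t x. 0 < t \<Longrightarrow> A * t powr (- (real DIM('a) / \<alpha>)) * exp (- B * ((norm x)\<^sup>2 * t powr (- (2 / \<alpha>))))
        \<le> stable_density \<alpha> t (x::'a::euclidean_space)"
proof -
  let ?g = "subord_density (\<alpha> / 2)"
  obtain p q m where pq: "0 < p" "p < q" and m: "0 < m"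
    and I: "has_bochner_integral lborel (\<lambda>u. indicator {p..q} u * ?g u) m"
    using subord_density_mass[of "\<alpha> / 2"] \<alpha> by auto
  show ?thesis
  proof (rule that)
    show "0 < m * (1 / sqrt (4 * pi * q)) ^ DIM('a)" "0 < 1 / (4 * p)"
      using pq m by auto
    fix t :: real and x :: 'a
    assume t: "0 < t"
    define c where "c = t powr (2 / \<alpha>)"
    have c: "c > 0" using t by (simp add: c_def)
    define K where "K = (1 / sqrt (4 * pi * (c * q))) ^ DIM('a) * exp (- (norm x)\<^sup>2 / (4 * (c * p)))"
    have sqrt_c: "1 / sqrt c = t powr (- (1 / \<alpha>))"
    proof -
      have "c = (t powr (1 / \<alpha>))\<^sup>2"
        using t by (simp add: c_def power2_eq_square powr_add[symmetric])
      thus ?thesis by (simp add: powr_minus_divide)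
    qed
    have "(1 / sqrt c) ^ DIM('a) = t powr (- (real DIM('a) / \<alpha>))"
      unfolding sqrt_c using t by (simp add: powr_realpow[symmetric] powr_powr)
    moreover have "1 / sqrt (4 * pi * (c * q)) = 1 / sqrt (4 * pi * q) * (1 / sqrt c)"
      by (simp add: real_sqrt_mult)
    ultimately have K: "K = (1 / sqrt (4 * pi * q)) ^ DIM('a) * t powr (- (real DIM('a) / \<alpha>)) *
        exp (- (norm x)\<^sup>2 / (4 * (c * p)))"
      by (simp only: K_def power_mult_distrib)
    have E: "- (norm x)\<^sup>2 / (4 * (c * p)) = - (1 / (4 * p)) * ((norm x)\<^sup>2 * t powr (- (2 / \<alpha>)))"
      using t pq by (simp add: c_def powr_minus field_simps)
    have "(\<integral>u. K * (indicator {p..q} u * ?g u) \<partial>lborel) \<le>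
        (\<integral>u. indicator {0<..} u * (heat_kernel (c * u) x * ?g u) \<partial>lborel)"
    proof (rule Bochner_Integration.integral_mono)
      show "integrable lborel (\<lambda>u. K * (indicator {p..q} u * ?g u))"
        using I by (simp add: has_bochner_integral_iff)
      show "integrable lborel (\<lambda>u. indicator {0<..} u * (heat_kernel (c * u) x * ?g u))"
        using stable_density_subordination[OF \<alpha> t, of x] by (simp add: has_bochner_integral_iff c_def)
      fix u :: real
      have g: "0 \<le> ?g u" using \<alpha> by (intro subord_density_nonneg) auto
      show "K * (indicator {p..q} u * ?g u) \<le> indicator {0<..} u * (heat_kernel (c * u) x * ?g u)"
      proof (cases "u \<in> {p..q}")
        case True
        hence u: "0 < u" "p \<le> u" "u \<le> q" using pq by auto
        have "K \<le> heat_kernel (c * u) x"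
          unfolding K_def heat_kernel_def using u c pq
          by (intro mult_mono power_mono) (auto intro!: divide_left_mono mult_pos_pos)
        thus ?thesis using True u g by (auto intro: mult_right_mono)
      next
        case False
        thus ?thesis using g c by (auto simp: indicator_def intro!: mult_nonneg_nonneg heat_kernel_nonneg)
      qed
    qed
    also have "(\<integral>u. K * (indicator {p..q} u * ?g u) \<partial>lborel) = K * m"
      using I by (simp add: has_bochner_integral_iff)
    also have "(\<integral>u. indicator {0<..} u * (heat_kernel (c * u) x * ?g u) \<partial>lborel) = stable_density \<alpha> t x"
      using stable_density_subordination[OF \<alpha> t, of x] by (simp add: has_bochner_integral_iff c_def)
    finally show "m * (1 / sqrt (4 * pi * q)) ^ DIM('a) * t powr (- (real DIM('a) / \<alpha>)) *
        exp (- (1 / (4 * p)) * ((norm x)\<^sup>2 * t powr (- (2 / \<alpha>)))) \<le> stable_density \<alpha> t x"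
      unfolding K E[symmetric] by (simp add: mult_ac)
  qed
qed

section \<open>The lower bound for the kernel \<open>Gkernel\<close>\<close>

lemma borel_measurable_stable_density [measurable (raw)]:
  assumes [measurable]: "f \<in> borel_measurable M"
  shows "(\<lambda>w. stable_density \<alpha> (f w) x) \<in> borel_measurable M"
  unfolding stable_density_def by measurable

text \<open>For u in [p, q] the time (t / u)^\<beta> is comparable to t^\<beta>, and |z| \<le> M
  t^(\<beta>/\<alpha>) keeps the Gaussian factor of the stable density away from 0. What remains is
  the prefactor t^(-\<beta> d/\<alpha>).\<close>

lemma Gkernel_lower:
  fixes \<alpha> \<beta> M :: real
  assumes \<alpha>: "0 < \<alpha>" "\<alpha> < 2" and \<beta>: "0 < \<beta>" "\<beta> < 1"
  obtains c where "0 < c"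
    "\<And>t z. 0 < t \<Longrightarrow> z \<noteq> 0 \<Longrightarrow> norm z \<le> M * t powr (\<beta> / \<alpha>) \<Longrightarrow>
       c * t powr (- (\<beta> * real DIM('a) / \<alpha>)) \<le> Gkernel \<alpha> \<beta> t (z::'a::euclidean_space)"
proof -
  let ?g = "subord_density \<beta>" and ?d = "real DIM('a)"
  have [measurable]: "?g \<in> borel_measurable borel"
    using \<beta> by (rule borel_measurable_subord_density)
  obtain p q m where pq: "0 < p" "p < q" and m: "0 < m"
    and I: "has_bochner_integral lborel (\<lambda>u. indicator {p..q} u * ?g u) m"
    using subord_density_mass[of \<beta>] \<beta> by auto
  obtain A B where A: "0 < A" and B: "0 < B" and
    low: "\<And>t x. 0 < t \<Longrightarrow> A * t powr (- (?d / \<alpha>)) * exp (- B * ((norm x)\<^sup>2 * t powr (- (2 / \<alpha>))))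
        \<le> stable_density \<alpha> t (x::'a)"
    using stable_density_lower[OF \<alpha>] by blast
  \<comment> \<open>The worst cases over u in [p, q]: the prefactor is smallest at u = p, the
    exponential at u = q with |z| as large as allowed.\<close>
  define L where "L = A * p powr (\<beta> * ?d / \<alpha>) * exp (- B * (M\<^sup>2 * q powr (2 * \<beta> / \<alpha>)))"
  show ?thesis
  proof (rule that)
    show "0 < m * L" using A m pq by (simp add: L_def)
    fix t :: real and z :: 'a
    assume t: "0 < t" and z: "z \<noteq> 0" and zM: "norm z \<le> M * t powr (\<beta> / \<alpha>)"
    define C where "C = exp (?d ^ 2) / norm z ^ DIM('a)"
    have int: "integrable lborel (\<lambda>u. indicator {0<..} u * (stable_density \<alpha> ((t / u) powr \<beta>) z * ?g u))"
    proof (rule Bochner_Integration.integrable_bound)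
      show "integrable lborel (\<lambda>u. C * (indicator {0<..} u * ?g u))"
        using has_bochner_integral_subord_density[OF \<beta>] by (simp add: has_bochner_integral_iff)
      show "AE u in lborel. norm (indicator {0<..} u * (stable_density \<alpha> ((t / u) powr \<beta>) z * ?g u))
              \<le> norm (C * (indicator {0<..} u * ?g u))"
      proof (rule AE_I2)
        fix u :: real
        show "norm (indicator {0<..} u * (stable_density \<alpha> ((t / u) powr \<beta>) z * ?g u))
              \<le> norm (C * (indicator {0<..} u * ?g u))"
        proof (cases "u > 0")
          case True
          have "0 \<le> stable_density \<alpha> ((t / u) powr \<beta>) z" "stable_density \<alpha> ((t / u) powr \<beta>) z \<le> C"
            unfolding C_def using \<alpha> t z True by (auto intro!: stable_density_nonneg stable_density_le)
          thus ?thesis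
            using True subord_density_nonneg[OF \<beta>, of u] by (auto simp: abs_mult intro!: mult_right_mono)
        qed simp
      qed
    qed simp
    have "(\<integral>u. (L * t powr (- (\<beta> * ?d / \<alpha>))) * (indicator {p..q} u * ?g u) \<partial>lborel) \<le>
        (\<integral>u. indicator {0<..} u * (stable_density \<alpha> ((t / u) powr \<beta>) z * ?g u) \<partial>lborel)"
    proof (rule Bochner_Integration.integral_mono[OF _ int])
      show "integrable lborel (\<lambda>u. (L * t powr (- (\<beta> * ?d / \<alpha>))) * (indicator {p..q} u * ?g u))"
        using I by (simp add: has_bochner_integral_iff)
      fix u :: real
      have g: "0 \<le> ?g u" using \<beta> by (intro subord_density_nonneg) auto
      show "(L * t powr (- (\<beta> * ?d / \<alpha>))) * (indicator {p..q} u * ?g u) \<le>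
          indicator {0<..} u * (stable_density \<alpha> ((t / u) powr \<beta>) z * ?g u)"
      proof (cases "u \<in> {p..q}")
        case True
        hence u: "0 < u" "p \<le> u" "u \<le> q" using pq by auto
        define s where "s = (t / u) powr \<beta>"
        have s: "s > 0" using t u by (simp add: s_def)
        have s1: "s powr (- (?d / \<alpha>)) = u powr (\<beta> * ?d / \<alpha>) * t powr (- (\<beta> * ?d / \<alpha>))"
          using t u by (simp add: s_def powr_powr powr_divide powr_minus field_simps)
        have s2: "s powr (- (2 / \<alpha>)) = u powr (2 * \<beta> / \<alpha>) * t powr (- (2 * \<beta> / \<alpha>))"
          using t u by (simp add: s_def powr_powr powr_divide powr_minus field_simps)
        have "(norm z)\<^sup>2 \<le> (M * t powr (\<beta> / \<alpha>))\<^sup>2"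
          using zM by (intro power_mono) auto
        also have "\<dots> = M\<^sup>2 * t powr (2 * \<beta> / \<alpha>)"
          using t by (simp add: power_mult_distrib power2_eq_square powr_add[symmetric])
        finally have zM2: "(norm z)\<^sup>2 \<le> M\<^sup>2 * t powr (2 * \<beta> / \<alpha>)" .
        have "u powr (2 * \<beta> / \<alpha>) \<le> q powr (2 * \<beta> / \<alpha>)"
          using u \<alpha> \<beta> by (intro powr_mono2) auto
        with zM2 have "(norm z)\<^sup>2 * s powr (- (2 / \<alpha>)) \<le>
            (M\<^sup>2 * t powr (2 * \<beta> / \<alpha>)) * (q powr (2 * \<beta> / \<alpha>) * t powr (- (2 * \<beta> / \<alpha>)))"
          unfolding s2 by (intro mult_mono) auto
        also have "\<dots> = M\<^sup>2 * q powr (2 * \<beta> / \<alpha>)"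
          using t by (simp add: powr_minus)
        finally have "exp (- B * (M\<^sup>2 * q powr (2 * \<beta> / \<alpha>))) \<le> exp (- B * ((norm z)\<^sup>2 * s powr (- (2 / \<alpha>))))"
          using B by simp
        moreover have "p powr (\<beta> * ?d / \<alpha>) * t powr (- (\<beta> * ?d / \<alpha>)) \<le> s powr (- (?d / \<alpha>))"
          unfolding s1 using u \<alpha> \<beta> pq by (intro mult_right_mono powr_mono2) auto
        ultimately have "A * (p powr (\<beta> * ?d / \<alpha>) * t powr (- (\<beta> * ?d / \<alpha>))) * exp (- B * (M\<^sup>2 * q powr (2 * \<beta> / \<alpha>))) \<le>
            A * s powr (- (?d / \<alpha>)) * exp (- B * ((norm z)\<^sup>2 * s powr (- (2 / \<alpha>))))"
          using A by (intro mult_mono) auto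
        also have "\<dots> \<le> stable_density \<alpha> s z"
          by (rule low[OF s])
        finally have "L * t powr (- (\<beta> * ?d / \<alpha>)) \<le> stable_density \<alpha> s z"
          by (simp add: L_def mult_ac)
        thus ?thesis using True u g by (auto simp: s_def intro: mult_right_mono)
      next
        case False
        have "0 \<le> stable_density \<alpha> ((t / u) powr \<beta>) z" if "u > 0"
          using that t \<alpha> by (intro stable_density_nonneg) auto
        thus ?thesis using False g by (auto simp: indicator_def)
      qed
    qed
    also have "(\<integral>u. (L * t powr (- (\<beta> * ?d / \<alpha>))) * (indicator {p..q} u * ?g u) \<partial>lborel) =
        m * L * t powr (- (\<beta> * ?d / \<alpha>))"
      using I by (simp add: has_bochner_integral_iff)
    also have "(\<integral>u. indicator {0<..} u * (stable_density \<alpha> ((t / u) powr \<beta>) z * ?g u) \<partial>lborel) = Gkernel \<alpha> \<beta> t z"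
      by (simp add: Gkernel_def set_lebesgue_integral_def)
    finally show "m * L * t powr (- (\<beta> * ?d / \<alpha>)) \<le> Gkernel \<alpha> \<beta> t z" .
  qed
qed

section \<open>Blow-up\<close>

lemma enn_powr_lower:
  assumes "ennreal h \<le> v" "0 \<le> h" "0 \<le> q"
  shows "ennreal (h powr q) \<le> enn_powr v q"
proof (cases "v = \<infinity>")
  case False
  then obtain w where w: "v = ennreal w" "0 \<le> w" by (cases v) auto
  with assms show ?thesis
    by (auto simp: enn_powr_def intro!: ennreal_leI powr_mono2)
qed (simp add: enn_powr_def)

text \<open>Isolates what drives the blow-up: the scale t^\<gamma>, on which the kernel is at least
  of order t^(-k), and the integral equation. The bound leaves out z = 0, where the kernel may be
  singular; a single point has measure zero.\<close>

locale duhamel =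
  fixes G :: "real \<Rightarrow> 'a::euclidean_space \<Rightarrow> real"
    and V0 :: "'a \<Rightarrow> real"
    and V :: "real \<Rightarrow> 'a \<Rightarrow> ennreal"
    and \<gamma> k \<eta> :: real
  assumes \<gamma>: "0 < \<gamma>"
    and k: "k = \<gamma> * real DIM('a)"
    and \<eta>: "0 < \<eta>"
    and subcritical: "k * \<eta> \<le> 1"
    and G_lower: "\<And>M. \<exists>c>0. \<forall>t>0. \<forall>z. z \<noteq> 0 \<longrightarrow> norm z \<le> M * t powr \<gamma> \<longrightarrow> c * t powr (- k) \<le> G t z"
    and V0_measurable: "V0 \<in> borel_measurable lborel"
    and V0_nonneg: "\<And>x. 0 \<le> V0 x"
    and V0_nontrivial: "\<not> (AE x in lborel. V0 x = 0)"
    and V_eq: "\<And>t x. 0 < t \<Longrightarrow> V t x =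
           (\<integral>\<^sup>+ y. ennreal (G t (x - y) * V0 y) \<partial>lborel) +
           (\<integral>\<^sup>+ y. (\<integral>\<^sup>+ s\<in>{0<..<t}. ennreal (G (t - s) (x - y)) * enn_powr (V s y) (1 + \<eta>) \<partial>lborel) \<partial>lborel)"
begin

lemma k_pos: "0 < k"
  using \<gamma> k by simp

lemma powr_gamma_power: "0 < s \<Longrightarrow> (s powr \<gamma>) ^ DIM('a) = s powr k"
  unfolding k by (simp add: powr_realpow[symmetric] powr_powr)

text \<open>The form in which the nonlinear term is used: the integrand is minorized by a function
  of s alone on a ball that may move and change size with s. The equation integrates over s first,
  so Fubini is applied to the minorant to bring out the volume of the ball.\<close>

lemma duhamel_lower:
  assumes t: "0 < t" and A: "A \<in> sets borel" "A \<subseteq> {0<..<t}"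
    and [measurable]: "\<phi> \<in> borel_measurable borel" "r \<in> borel_measurable borel" "p \<in> borel_measurable borel"
    and low: "\<And>s y. s \<in> A \<Longrightarrow> y \<in> ball (p s) (r s) \<Longrightarrow> y \<noteq> x \<Longrightarrow>
                \<phi> s \<le> ennreal (G (t - s) (x - y)) * enn_powr (V s y) (1 + \<eta>)"
  shows "(\<integral>\<^sup>+s\<in>A. \<phi> s * emeasure lborel (ball (p s) (r s)) \<partial>lborel) \<le> V t x"
proof -
  note A(1)[measurable]
  \<comment> \<open>The indicator of the ball becomes a condition on \<open>dist (p s) y\<close>,
    which is jointly measurable in s and y.\<close>
  have "(\<integral>\<^sup>+s\<in>A. \<phi> s * emeasure lborel (ball (p s) (r s)) \<partial>lborel) =
     (\<integral>\<^sup>+s. (\<integral>\<^sup>+y. \<phi> s * indicator A s * (if dist (p s) y < r s then 1 else 0) \<partial>lborel) \<partial>lborel)"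
  proof (rule nn_integral_cong)
    fix s
    have [measurable]: "ball (p s) (r s) \<in> sets borel" by simp
    have "(\<integral>\<^sup>+y. \<phi> s * indicator A s * (if dist (p s) y < r s then 1 else 0) \<partial>lborel) =
        \<phi> s * indicator A s * (\<integral>\<^sup>+y. indicator (ball (p s) (r s)) y \<partial>lborel)"
      by (subst nn_integral_cmult[symmetric]) (auto intro!: nn_integral_cong simp: indicator_def)
    thus "\<phi> s * emeasure lborel (ball (p s) (r s)) * indicator A s =
        (\<integral>\<^sup>+y. \<phi> s * indicator A s * (if dist (p s) y < r s then 1 else 0) \<partial>lborel)"
      by (simp add: mult_ac)
  qed
  also have "\<dots> = (\<integral>\<^sup>+y. (\<integral>\<^sup>+s. \<phi> s * indicator A s * (if dist (p s) y < r s then 1 else 0) \<partial>lborel) \<partial>lborel)"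
    by (rule lborel_pair.Fubini'[symmetric]) measurable
  also have "\<dots> \<le> (\<integral>\<^sup>+ y. (\<integral>\<^sup>+ s\<in>{0<..<t}. ennreal (G (t - s) (x - y)) * enn_powr (V s y) (1 + \<eta>) \<partial>lborel) \<partial>lborel)"
  proof (rule nn_integral_mono_AE, rule AE_mp[OF AE_lborel_singleton[of x]], rule AE_I2, rule impI)
    fix y assume y: "y \<noteq> x"
    show "(\<integral>\<^sup>+s. \<phi> s * indicator A s * (if dist (p s) y < r s then 1 else 0) \<partial>lborel) \<le>
       (\<integral>\<^sup>+ s\<in>{0<..<t}. ennreal (G (t - s) (x - y)) * enn_powr (V s y) (1 + \<eta>) \<partial>lborel)"
      using low[OF _ _ y] A(2) by (intro nn_integral_mono) (auto simp: indicator_def)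
  qed
  also have "\<dots> \<le> V t x"
    unfolding V_eq[OF t] by simp
  finally show ?thesis .
qed

text \<open>Some ball around 0 carries positive mass of \<open>V0\<close>. Once t^\<gamma> exceeds
  its radius, the kernel bound applies to every pair of points involved, and the linear term alone
  is of order t^(-k).\<close>

lemma linear_decay:
  obtains c t1 where "0 < c" "1 \<le> t1"
    "\<And>t x. t1 \<le> t \<Longrightarrow> norm x \<le> t powr \<gamma> \<Longrightarrow> ennreal (c * t powr (- k)) \<le> V t x"
proof -
  have [measurable]: "V0 \<in> borel_measurable borel"
    using V0_measurable by simp
  have [measurable]: "ball (0::'a) (real n) \<in> sets borel" for n
    by simp
  have "\<exists>n. (\<integral>\<^sup>+y. ennreal (V0 y) * indicator (ball 0 (real n)) y \<partial>lborel) \<noteq> 0"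
  proof (rule ccontr)
    assume "\<not> ?thesis"
    hence *: "(\<integral>\<^sup>+y. ennreal (V0 y) * indicator (ball 0 (real n)) y \<partial>lborel) = 0" for n
      by simp
    have "AE y in lborel. ennreal (V0 y) * indicator (ball 0 (real n)) y = 0" for n
      by (subst nn_integral_0_iff_AE[symmetric], measurable) (rule *)
    hence "AE y in lborel. \<forall>n. ennreal (V0 y) * indicator (ball 0 (real n)) y = 0"
      unfolding AE_all_countable by blast
    hence "AE y in lborel. V0 y = 0"
    proof eventually_elim
      case (elim y)
      obtain n where "norm y < real n" using reals_Archimedean2 by blast
      with elim[rule_format, of n] V0_nonneg[of y] show ?case by (simp add: ennreal_eq_0_iff)
    qed
    thus False using V0_nontrivial by simp
  qed
  then obtain n where n: "(\<integral>\<^sup>+y. ennreal (V0 y) * indicator (ball 0 (real n)) y \<partial>lborel) \<noteq> 0" (is "?I \<noteq> 0") ..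
  \<comment> \<open>The mass of \<open>V0\<close> on the ball may be infinite; capping it at 1 gives
    a positive real.\<close>
  define w where "w = enn2real (min 1 ?I)"
  have w: "ennreal w \<le> ?I" "0 < w"
  proof -
    have "min 1 ?I < \<top>" by (simp add: min_less_iff_disj)
    hence "ennreal w = min 1 ?I" by (simp add: w_def)
    thus "ennreal w \<le> ?I" by simp
    have "min 1 ?I \<noteq> 0" using n by (auto simp: min_def)
    thus "0 < w" using \<open>ennreal w = min 1 ?I\<close> by (metis ennreal_eq_0_iff not_less)
  qed
  obtain c0 where c0: "0 < c0" "\<And>t z. 0 < t \<Longrightarrow> z \<noteq> 0 \<Longrightarrow> norm z \<le> 2 * t powr \<gamma> \<Longrightarrow> c0 * t powr (- k) \<le> G t z"
    using G_lower[of 2] by blast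
  show ?thesis
  proof (rule that)
    show "0 < c0 * w" using c0 w by simp
    show "1 \<le> max 1 (real n powr (1 / \<gamma>))" by simp
    fix t and x :: 'a
    assume t: "max 1 (real n powr (1 / \<gamma>)) \<le> t" and x: "norm x \<le> t powr \<gamma>"
    hence t0: "t > 0" by simp
    have "real n = (real n powr (1 / \<gamma>)) powr \<gamma>"
      using \<gamma> by (simp add: powr_powr)
    also have "\<dots> \<le> t powr \<gamma>"
      using t \<gamma> by (intro powr_mono2) auto
    finally have nt: "real n \<le> t powr \<gamma>" .
    have "ennreal (c0 * w * t powr (- k)) = ennreal (c0 * t powr (- k)) * ennreal w"
      using c0 w by (simp add: ennreal_mult''[symmetric] mult_ac)
    also have "\<dots> \<le> ennreal (c0 * t powr (- k)) * ?I"
      using w by (intro mult_left_mono) auto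
    also have "\<dots> = (\<integral>\<^sup>+y. ennreal (c0 * t powr (- k)) * (ennreal (V0 y) * indicator (ball 0 (real n)) y) \<partial>lborel)"
      by (rule nn_integral_cmult[symmetric]) simp
    also have "\<dots> \<le> (\<integral>\<^sup>+ y. ennreal (G t (x - y) * V0 y) \<partial>lborel)"
    proof (rule nn_integral_mono_AE, rule AE_mp[OF AE_lborel_singleton[of x]], rule AE_I2, rule impI)
      fix y assume y: "y \<noteq> x"
      show "ennreal (c0 * t powr (- k)) * (ennreal (V0 y) * indicator (ball 0 (real n)) y) \<le> ennreal (G t (x - y) * V0 y)"
      proof (cases "y \<in> ball 0 (real n)")
        case True
        have "norm (x - y) \<le> norm x + norm y" by (rule norm_triangle_ineq4)
        hence "norm (x - y) \<le> 2 * t powr \<gamma>" using x nt True by simp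
        hence "c0 * t powr (- k) \<le> G t (x - y)"
          using y t0 by (intro c0) auto
        hence "c0 * t powr (- k) * V0 y \<le> G t (x - y) * V0 y"
          using V0_nonneg by (rule mult_right_mono)
        thus ?thesis
          using True c0 V0_nonneg[of y] by (simp add: ennreal_mult''[symmetric] ennreal_leI)
      qed simp
    qed
    also have "\<dots> \<le> V t x"
      unfolding V_eq[OF t0] by simp
    finally show "ennreal (c0 * w * t powr (- k)) \<le> V t x" .
  qed
qed

text \<open>Inserting s^(-k) into the nonlinear term and integrating over the ball of radius
  s^\<gamma>, of volume of order s^k, leaves s^(-k \<eta>). By k \<eta> \<le> 1 this is at least 1 /
  s for s \<ge> 1, and integration over [t1, t/2] produces the logarithm.\<close>

lemma logarithmic_gain:
  obtains c t1 where "0 < c" "1 \<le> t1"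
    "\<And>t x. 2 * t1 \<le> t \<Longrightarrow> norm x \<le> t powr \<gamma> \<Longrightarrow> ennreal (c * ln (t / (2 * t1)) * t powr (- k)) \<le> V t x"
proof -
  obtain c1 t1 where c1: "0 < c1" and t1: "1 \<le> t1"
    and V_low: "\<And>t x. t1 \<le> t \<Longrightarrow> norm x \<le> t powr \<gamma> \<Longrightarrow> ennreal (c1 * t powr (- k)) \<le> V t x"
    using linear_decay by blast
  \<comment> \<open>For s \<le> t / 2 one has t \<le> 2 (t - s), so |x - y| \<le> 2 t^\<gamma> is at
    most M (t - s)^\<gamma>.\<close>
  define M where "M = 2 * 2 powr \<gamma>"
  obtain c0 where c0: "0 < c0" "\<And>t z. 0 < t \<Longrightarrow> z \<noteq> 0 \<Longrightarrow> norm z \<le> M * t powr \<gamma> \<Longrightarrow> c0 * t powr (- k) \<le> G t z"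
    using G_lower[of M] by blast
  define C where "C = c0 * c1 powr (1 + \<eta>) * unit_ball_vol (real DIM('a))"
  show ?thesis
  proof (rule that)
    show "0 < C" using c0 c1 by (simp add: C_def)
    show "1 \<le> t1" by (rule t1)
    fix t and x :: 'a
    assume t: "2 * t1 \<le> t" and x: "norm x \<le> t powr \<gamma>"
    have t0: "t > 0" using t t1 by simp
    define \<phi> where "\<phi> s = ennreal (c0 * t powr (- k) * (c1 * s powr (- k)) powr (1 + \<eta>))" for s
    have [measurable]: "\<phi> \<in> borel_measurable borel" unfolding \<phi>_def by measurable
    have "ennreal (C * ln (t / (2 * t1)) * t powr (- k)) = ennreal (C * t powr (- k)) * ennreal (ln (t / 2) - ln t1)"
    proof -
      have "ln (t / (2 * t1)) = ln (t / 2) - ln t1"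
        using t0 t1 by (simp add: ln_div ln_mult)
      moreover have "0 \<le> C * t powr (- k)" using c0 c1 by (simp add: C_def)
      ultimately show ?thesis by (simp add: ennreal_mult'[symmetric] mult_ac)
    qed
    also have "ennreal (ln (t / 2) - ln t1) = (\<integral>\<^sup>+s. ennreal (1 / s) * indicator {t1..t / 2} s \<partial>lborel)"
      using t t1 by (intro nn_integral_FTC_Icc[symmetric]) (auto intro!: derivative_eq_intros)
    also have "ennreal (C * t powr (- k)) * \<dots> = (\<integral>\<^sup>+s. ennreal (C * t powr (- k)) * (ennreal (1 / s) * indicator {t1..t / 2} s) \<partial>lborel)"
      by (rule nn_integral_cmult[symmetric]) simp
    also have "\<dots> \<le> (\<integral>\<^sup>+s\<in>{t1..t / 2}. \<phi> s * emeasure lborel (ball (0::'a) (s powr \<gamma>)) \<partial>lborel)"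
    proof (rule nn_integral_mono)
      fix s
      show "ennreal (C * t powr (- k)) * (ennreal (1 / s) * indicator {t1..t / 2} s) \<le>
          \<phi> s * emeasure lborel (ball (0::'a) (s powr \<gamma>)) * indicator {t1..t / 2} s"
      proof (cases "s \<in> {t1..t / 2}")
        case True
        hence s: "1 \<le> s" using t1 by simp
        have "1 / s = s powr (- 1)" using s by (simp add: powr_minus_divide)
        also have "\<dots> \<le> s powr (- (k * \<eta>))"
          using s subcritical by (intro powr_mono) auto
        also have "\<dots> = (s powr (- k)) powr (1 + \<eta>) * s powr k"
          using s by (simp add: powr_powr powr_add[symmetric] algebra_simps)
        finally have "C * t powr (- k) * (1 / s) \<le> C * t powr (- k) * ((s powr (- k)) powr (1 + \<eta>) * s powr k)"
          using c0 c1 by (intro mult_left_mono) (auto simp: C_def)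
        also have "\<dots> = c0 * t powr (- k) * (c1 * s powr (- k)) powr (1 + \<eta>) * (unit_ball_vol (real DIM('a)) * (s powr \<gamma>) ^ DIM('a))"
          using s c1 by (simp add: C_def powr_gamma_power powr_mult mult_ac)
        finally show ?thesis
          using True s c0 by (simp add: \<phi>_def emeasure_ball ennreal_mult''[symmetric] ennreal_leI)
      qed simp
    qed
    also have "\<dots> \<le> V t x"
    proof (rule duhamel_lower)
      show "{t1..t / 2} \<subseteq> {0<..<t}" using t1 t0 by auto
      fix s y assume s: "s \<in> {t1..t / 2}" and y: "y \<in> ball (0::'a) (s powr \<gamma>)" and yx: "y \<noteq> x"
      have s': "1 \<le> s" "s \<le> t / 2" "0 < t - s" "t \<le> 2 * (t - s)" using s t1 t0 by auto
      have "norm (x - y) \<le> norm x + norm y" by (rule norm_triangle_ineq4)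
      also have "\<dots> \<le> t powr \<gamma> + t powr \<gamma>"
      proof (rule add_mono[OF x])
        have "s powr \<gamma> \<le> t powr \<gamma>" using s' t0 \<gamma> by (intro powr_mono2) auto
        thus "norm y \<le> t powr \<gamma>" using y by simp
      qed
      also have "\<dots> \<le> 2 * (2 * (t - s)) powr \<gamma>"
        using s' t0 \<gamma> powr_mono2[of \<gamma> t "2 * (t - s)"] by simp
      also have "\<dots> = M * (t - s) powr \<gamma>"
        unfolding M_def using s' by (subst powr_mult) auto
      finally have "c0 * (t - s) powr (- k) \<le> G (t - s) (x - y)"
        using s' yx by (intro c0) auto
      moreover have "c0 * t powr (- k) \<le> c0 * (t - s) powr (- k)"
        using s' c0 k_pos by (intro mult_left_mono powr_mono2') auto
      ultimately have "ennreal (c0 * t powr (- k)) \<le> ennreal (G (t - s) (x - y))"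
        by (intro ennreal_leI) linarith
      moreover have "ennreal ((c1 * s powr (- k)) powr (1 + \<eta>)) \<le> enn_powr (V s y) (1 + \<eta>)"
        using V_low[of s y] s y c1 \<eta> by (intro enn_powr_lower) auto
      ultimately show "\<phi> s \<le> ennreal (G (t - s) (x - y)) * enn_powr (V s y) (1 + \<eta>)"
        unfolding \<phi>_def using c0 by (subst ennreal_mult'') (auto intro: mult_mono)
    qed (use t0 in auto)
    finally show "ennreal (C * ln (t / (2 * t1)) * t powr (- k)) \<le> V t x" .
  qed
qed

text \<open>At time s the kernel bound (t - s)^(-k) holds within distance (t - s)^\<gamma> of x, and
  a ball of half that radius has volume of order (t - s)^k. The product does not depend on s, so the
  gain is linear in the elapsed time t - a.\<close>

lemma local_gain:
  obtains c where "0 < c"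
    "\<And>T a h t x. 0 < T \<Longrightarrow> T \<le> a \<Longrightarrow> 0 \<le> h \<Longrightarrow> a < t \<Longrightarrow> t \<le> 2 * T \<Longrightarrow> norm x < T powr \<gamma> \<Longrightarrow>
       (\<And>s y. a < s \<Longrightarrow> s \<le> 2 * T \<Longrightarrow> norm y < T powr \<gamma> \<Longrightarrow> ennreal h \<le> V s y) \<Longrightarrow>
       ennreal (c * (t - a) * h powr (1 + \<eta>)) \<le> V t x"
proof -
  obtain c0 where c0: "0 < c0" "\<And>t z. 0 < t \<Longrightarrow> z \<noteq> 0 \<Longrightarrow> norm z \<le> 1 * t powr \<gamma> \<Longrightarrow> c0 * t powr (- k) \<le> G t z"
    using G_lower[of 1] by blast
  define c where "c = c0 * unit_ball_vol (real DIM('a)) * (1 / 2) ^ DIM('a)"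
  show ?thesis
  proof (rule that)
    show "0 < c" using c0 by (simp add: c_def)
    fix T a h t and x :: 'a
    assume T: "0 < T" "T \<le> a" and h: "0 \<le> h" and t: "a < t" "t \<le> 2 * T" and x: "norm x < T powr \<gamma>"
      and V_low: "\<And>s y. a < s \<Longrightarrow> s \<le> 2 * T \<Longrightarrow> norm y < T powr \<gamma> \<Longrightarrow> ennreal h \<le> V s y"
    define R where "R = T powr \<gamma>"
    have R: "R > 0" using T by (simp add: R_def)
    define \<phi> where "\<phi> s = ennreal (c0 * (t - s) powr (- k) * h powr (1 + \<eta>))" for s
    define r where "r s = (t - s) powr \<gamma> / 2" for s
    \<comment> \<open>A ball centred at x could leave the region where V \<ge> h is known. Pulling
      the centre towards 0 by at most \<open>r s\<close> keeps the ball inside radius R and all its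
      points within \<open>2 * r s\<close> of x.\<close>
    define p where "p s = (1 - r s / R) *\<^sub>R x" for s
    have [measurable]: "\<phi> \<in> borel_measurable borel" "r \<in> borel_measurable borel"
      unfolding \<phi>_def r_def by measurable
    have [measurable]: "p \<in> borel_measurable borel"
      unfolding p_def by measurable
    have "ennreal (c * (t - a) * h powr (1 + \<eta>)) = ennreal (c * h powr (1 + \<eta>)) * emeasure lborel {a<..<t}"
      using t c0 by (simp add: ennreal_mult''[symmetric] c_def mult_ac)
    also have "\<dots> = (\<integral>\<^sup>+s. ennreal (c * h powr (1 + \<eta>)) * indicator {a<..<t} s \<partial>lborel)"
      by (rule nn_integral_cmult_indicator[symmetric]) simp
    also have "\<dots> = (\<integral>\<^sup>+s\<in>{a<..<t}. \<phi> s * emeasure lborel (ball (p s) (r s)) \<partial>lborel)"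
    proof (rule nn_integral_cong)
      fix s
      show "ennreal (c * h powr (1 + \<eta>)) * indicator {a<..<t} s = \<phi> s * emeasure lborel (ball (p s) (r s)) * indicator {a<..<t} s"
      proof (cases "s \<in> {a<..<t}")
        case True
        hence "(r s) ^ DIM('a) = (t - s) powr k * (1 / 2) ^ DIM('a)"
          by (simp add: r_def power_divide powr_gamma_power)
        moreover have "(t - s) powr (- k) * (t - s) powr k = 1"
          using True by (simp add: powr_add[symmetric])
        ultimately have mass: "c0 * (t - s) powr (- k) * h powr (1 + \<eta>) * (unit_ball_vol (real DIM('a)) * (r s) ^ DIM('a)) = c * h powr (1 + \<eta>)"
          by (simp add: c_def)
        have "0 \<le> r s" by (simp add: r_def)
        hence "\<phi> s * emeasure lborel (ball (p s) (r s)) =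
            ennreal (c0 * (t - s) powr (- k) * h powr (1 + \<eta>) * (unit_ball_vol (real DIM('a)) * (r s) ^ DIM('a)))"
          by (simp add: \<phi>_def emeasure_ball ennreal_mult''[symmetric])
        thus ?thesis
          unfolding mass by simp
      qed simp
    qed
    also have "\<dots> \<le> V t x"
    proof (rule duhamel_lower)
      show "0 < t" "{a<..<t} \<subseteq> {0<..<t}" using T t by auto
      fix s y assume s: "s \<in> {a<..<t}" and y: "y \<in> ball (p s) (r s)" and yx: "y \<noteq> x"
      \<comment> \<open>T \<le> a < s and t \<le> 2 T force t - s \<le> T.\<close>
      have "(t - s) powr \<gamma> \<le> R"
        unfolding R_def using s t T \<gamma> by (intro powr_mono2) auto
      hence r: "0 \<le> r s" "r s \<le> R / 2" "2 * r s = (t - s) powr \<gamma>" by (auto simp: r_def)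
      have "norm (p s) = (1 - r s / R) * norm x"
        using r R by (simp add: p_def)
      also have "\<dots> \<le> (1 - r s / R) * R"
        using r R x by (intro mult_left_mono) (auto simp: R_def)
      also have "\<dots> = R - r s" using R by (simp add: field_simps)
      finally have pR: "norm (p s) \<le> R - r s" .
      have "p s - x = - (r s / R) *\<^sub>R x"
        by (simp add: p_def algebra_simps)
      hence "norm (p s - x) = r s / R * norm x"
        using r R by simp
      also have "\<dots> \<le> r s / R * R"
        using r R x by (intro mult_left_mono) (auto simp: R_def)
      finally have px: "norm (p s - x) \<le> r s" using R by simp
      have py: "norm (p s - y) < r s" using y by (simp add: dist_norm)
      have "norm y \<le> norm (p s) + norm (p s - y)"
        by (metis norm_triangle_ineq4 diff_diff_eq2 add_diff_cancel_left')
      hence "norm y < T powr \<gamma>" using pR py by (simp add: R_def)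
      hence V: "ennreal h \<le> V s y" using s t by (intro V_low) auto
      have "x - y = (p s - y) - (p s - x)" by simp
      hence "norm (x - y) \<le> norm (p s - y) + norm (p s - x)"
        by (metis norm_triangle_ineq4)
      hence "norm (x - y) \<le> 1 * (t - s) powr \<gamma>" using px py r by linarith
      hence "c0 * (t - s) powr (- k) \<le> G (t - s) (x - y)"
        using s yx by (intro c0) auto
      hence "ennreal (c0 * (t - s) powr (- k)) \<le> ennreal (G (t - s) (x - y))"
        by (rule ennreal_leI)
      moreover have "ennreal (h powr (1 + \<eta>)) \<le> enn_powr (V s y) (1 + \<eta>)"
        using V h \<eta> by (intro enn_powr_lower) auto
      ultimately show "\<phi> s \<le> ennreal (G (t - s) (x - y)) * enn_powr (V s y) (1 + \<eta>)"
        unfolding \<phi>_def using c0 by (subst ennreal_mult'') (auto intro: mult_mono)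
    qed (use T t in auto)
    finally show "ennreal (c * (t - a) * h powr (1 + \<eta>)) \<le> V t x" .
  qed
qed

text \<open>The n-th stage has elapsed time at least T / 2^(n+1), while the level m q^n contributes
  (q^n)^\<eta> = 2^n through the nonlinearity. The two effects cancel, so each stage multiplies the
  level by at least q > 1 and infinitely many stages fit before time 2 T.\<close>

lemma local_blowup:
  obtains T0 where "1 \<le> T0" "\<And>T x. T0 \<le> T \<Longrightarrow> norm x < T powr \<gamma> \<Longrightarrow> V (2 * T) x = \<infinity>"
proof -
  obtain c t1 where c: "0 < c" and t1: "1 \<le> t1"
    and V_low: "\<And>t x. 2 * t1 \<le> t \<Longrightarrow> norm x \<le> t powr \<gamma> \<Longrightarrow> ennreal (c * ln (t / (2 * t1)) * t powr (- k)) \<le> V t x"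
    using logarithmic_gain by blast
  obtain c' where c': "0 < c'" and
    gain: "\<And>T a h t x. 0 < T \<Longrightarrow> T \<le> a \<Longrightarrow> 0 \<le> h \<Longrightarrow> a < t \<Longrightarrow> t \<le> 2 * T \<Longrightarrow> norm x < T powr \<gamma> \<Longrightarrow>
       (\<And>s y. a < s \<Longrightarrow> s \<le> 2 * T \<Longrightarrow> norm y < T powr \<gamma> \<Longrightarrow> ennreal h \<le> V s y) \<Longrightarrow>
       ennreal (c' * (t - a) * h powr (1 + \<eta>)) \<le> V t x"
    using local_gain by blast
  define q where "q = 2 powr (1 / \<eta>)"
  have q: "q > 1" using \<eta> by (simp add: q_def)
  have q_eta: "q powr \<eta> = 2" using \<eta> by (simp add: q_def powr_powr)
  \<comment> \<open>With the starting level m chosen below, the gain factor c' T m^\<eta> / 2 equals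
    K X^\<eta> T^(1 - k \<eta>). The next choice gives K X^\<eta> = q, and \<open>T0\<close> makes
    the logarithm at least X from there on.\<close>
  define K where "K = c' / 2 * (c * 2 powr (- k)) powr \<eta>"
  have K: "K > 0" using c c' by (simp add: K_def)
  define X where "X = (q / K) powr (1 / \<eta>)"
  have X: "X > 0" using q K by (simp add: X_def)
  have X_eta: "K * X powr \<eta> = q" using \<eta> q K by (simp add: X_def powr_powr)
  define T0 where "T0 = 2 * t1 * exp X"
  have T0: "2 * t1 \<le> T0" using t1 X by (simp add: T0_def)
  show ?thesis
  proof (rule that)
    show "1 \<le> T0" using T0 t1 by simp
    fix T and x :: 'a
    assume T: "T0 \<le> T" and x: "norm x < T powr \<gamma>"
    have T1: "1 \<le> T" "2 * t1 \<le> T" using T T0 t1 by auto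
    have "exp X \<le> T / (2 * t1)"
      using T t1 by (simp add: T0_def field_simps)
    hence lnX: "X \<le> ln (T / (2 * t1))"
      using T1 t1 by (subst ln_ge_iff) auto
    define m where "m = c * X * (2 * T) powr (- k)"
    have m: "m > 0" using c X T1 by (simp add: m_def)
    have m_large: "q \<le> c' * T / 2 * m powr \<eta>"
    proof -
      have "m powr \<eta> = (c * 2 powr (- k)) powr \<eta> * X powr \<eta> * T powr (- (k * \<eta>))"
        using c X T1 by (simp add: m_def powr_mult powr_powr)
      hence "c' * T / 2 * m powr \<eta> = q * (T * T powr (- (k * \<eta>)))"
        unfolding X_eta[symmetric] by (simp add: K_def)
      also have "T * T powr (- (k * \<eta>)) = T powr (1 - k * \<eta>)"
        using T1 by (simp add: powr_mult_base)
      \<comment> \<open>Here k \<eta> \<le> 1 enters again. In the critical case the power of T is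
        1, and the size of the factor comes from the logarithm alone.\<close>
      also have "q * 1 \<le> q * T powr (1 - k * \<eta>)"
        using q T1 subcritical by (intro mult_left_mono ge_one_powr_ge_zero) auto
      finally show ?thesis by simp
    qed
    define a where "a n = T * (2 - (1 / 2) ^ n)" for n :: nat
    have aT: "T \<le> a n" "a n < 2 * T" for n
      using T1 power_le_one[of "1/2::real" n] by (auto simp: a_def)
    have step: "ennreal (m * q ^ n) \<le> V s y" if "a n < s" "s \<le> 2 * T" "norm y < T powr \<gamma>" for n s y
      using that
    proof (induction n arbitrary: s y)
      case 0
      have "c * X * (2 * T) powr (- k) \<le> c * ln (s / (2 * t1)) * s powr (- k)"
      proof (intro mult_mono mult_left_mono)
        have "ln (T / (2 * t1)) \<le> ln (s / (2 * t1))"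
          using 0 T1 t1 by (subst ln_le_cancel_iff) (auto simp: a_def divide_right_mono)
        thus "X \<le> ln (s / (2 * t1))" using lnX by simp
        thus "0 \<le> c * ln (s / (2 * t1))" using c X by simp
        show "(2 * T) powr (- k) \<le> s powr (- k)"
          using 0 T1 k_pos by (intro powr_mono2') (auto simp: a_def)
      qed (use c X in auto)
      hence "ennreal m \<le> ennreal (c * ln (s / (2 * t1)) * s powr (- k))"
        unfolding m_def by (rule ennreal_leI)
      also have "\<dots> \<le> V s y"
      proof (rule V_low)
        have "T powr \<gamma> \<le> s powr \<gamma>"
          using 0 T1 \<gamma> by (intro powr_mono2) (auto simp: a_def)
        thus "norm y \<le> s powr \<gamma>" using 0 by simp
      qed (use 0 T1 in \<open>simp add: a_def\<close>)
      finally show ?case by simp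
    next
      case (Suc n)
      \<comment> \<open>The lower bound is the distance between consecutive starting times
        \<open>a n\<close> and \<open>a (Suc n)\<close>.\<close>
      have ext: "a n < a (Suc n)" "T * (1 / 2) ^ Suc n \<le> s - a n"
        using Suc.prems T1 by (auto simp: a_def algebra_simps)
      have "(q ^ n) powr \<eta> = (q powr \<eta>) ^ n"
        using q by (simp add: powr_realpow[symmetric] powr_powr mult.commute)
      hence "(q ^ n) powr \<eta> = 2 ^ n"
        by (simp only: q_eta)
      have "m * q ^ n * q \<le> m * q ^ n * (c' * T / 2 * m powr \<eta>)"
        using m q m_large by (intro mult_left_mono) auto
      also have "\<dots> = c' * (T * (1 / 2) ^ Suc n) * (m * q ^ n) powr (1 + \<eta>)"
        using m q \<open>(q ^ n) powr \<eta> = 2 ^ n\<close> by (simp add: powr_add powr_mult power_divide)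
      also have "\<dots> \<le> c' * (s - a n) * (m * q ^ n) powr (1 + \<eta>)"
        using ext c' by (intro mult_right_mono mult_left_mono) auto
      finally have "ennreal (m * q ^ Suc n) \<le> ennreal (c' * (s - a n) * (m * q ^ n) powr (1 + \<eta>))"
        by (intro ennreal_leI) (simp add: mult_ac)
      also have "\<dots> \<le> V s y"
        using Suc aT[of n] T1 ext m q by (intro gain[of T]) auto
      finally show ?case .
    qed
    \<comment> \<open>Time 2 T belongs to every window, as all starting times lie strictly below
      it.\<close>
    have big: "ennreal (m * q ^ n) \<le> V (2 * T) x" for n
      using aT x by (intro step) auto
    show "V (2 * T) x = \<infinity>"
    proof (rule ccontr)
      assume "V (2 * T) x \<noteq> \<infinity>"
      then obtain v where v: "V (2 * T) x = ennreal v" "0 \<le> v" by (cases "V (2 * T) x") auto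
      obtain n where "v / m < q ^ n" using q real_arch_pow by blast
      hence "v < m * q ^ n" using m by (simp add: field_simps)
      thus False using big[of n] v by simp
    qed
  qed
qed

text \<open>Local blow-up with T = s / 2 makes V infinite on one fixed ball at every time s > 2 T0.
  The kernel from that ball to any x is strictly positive, so the nonlinear term at a later time
  integrates infinity over a set of positive measure.\<close>

lemma global_blowup: "\<exists>t0>0. \<forall>t>t0. \<forall>x. V t x = \<infinity>"
proof -
  obtain T0 where T0: "1 \<le> T0" and blow: "\<And>T x. T0 \<le> T \<Longrightarrow> norm x < T powr \<gamma> \<Longrightarrow> V (2 * T) x = \<infinity>"
    using local_blowup by blast
  have "V t x = \<infinity>" if t: "2 * T0 < t" for t x
  proof -
    define R where "R = T0 powr \<gamma>"
    have R: "R > 0" using T0 by (simp add: R_def)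
    \<comment> \<open>Only the first half of the interval from 2 T0 to t is used. There t - s \<ge>
      e, so \<open>M\<close>, fitted to the time e, covers all distances |x - y| \<le> |x| +
      R.\<close>
    define e where "e = (t - 2 * T0) / 2"
    have e: "e > 0" using t by (simp add: e_def)
    define M where "M = (norm x + R) / e powr \<gamma>"
    obtain c0 where c0: "0 < c0" "\<And>t z. 0 < t \<Longrightarrow> z \<noteq> 0 \<Longrightarrow> norm z \<le> M * t powr \<gamma> \<Longrightarrow> c0 * t powr (- k) \<le> G t z"
      using G_lower[of M] by blast
    have "0 < unit_ball_vol (real DIM('a)) * R ^ DIM('a)"
      using R by simp
    hence vol: "emeasure lborel (ball (0::'a) R) \<noteq> 0"
      using R by (simp only: emeasure_ball less_imp_le ennreal_eq_0_iff not_le)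
    have "\<infinity> = (\<integral>\<^sup>+s. \<infinity> * indicator {2 * T0<..<2 * T0 + e} s \<partial>lborel)"
      using e by (subst nn_integral_cmult_indicator) (auto simp: ennreal_top_mult)
    also have "\<dots> = (\<integral>\<^sup>+s\<in>{2 * T0<..<2 * T0 + e}. \<infinity> * emeasure lborel (ball (0::'a) R) \<partial>lborel)"
      using vol by (simp add: ennreal_top_mult)
    also have "\<dots> \<le> V t x"
    proof (rule duhamel_lower)
      show "0 < t" "{2 * T0<..<2 * T0 + e} \<subseteq> {0<..<t}" using T0 t by (auto simp: e_def field_simps)
      fix s y assume s: "s \<in> {2 * T0<..<2 * T0 + e}" and y: "y \<in> ball (0::'a) R" and yx: "y \<noteq> x"
      have ts: "e \<le> t - s" using s by (simp add: e_def field_simps)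
      have "R \<le> (s / 2) powr \<gamma>"
        unfolding R_def using s T0 \<gamma> by (intro powr_mono2) auto
      hence "V (2 * (s / 2)) y = \<infinity>"
        using s y by (intro blow) auto
      hence 1: "enn_powr (V s y) (1 + \<eta>) = \<infinity>" by (simp add: enn_powr_def)
      have "norm (x - y) \<le> norm x + norm y" by (rule norm_triangle_ineq4)
      also have "\<dots> \<le> norm x + R" using y by simp
      also have "\<dots> = M * e powr \<gamma>" using e by (simp add: M_def)
      also have "\<dots> \<le> M * (t - s) powr \<gamma>"
        using ts e \<gamma> R by (intro mult_left_mono powr_mono2) (auto simp: M_def)
      finally have "c0 * (t - s) powr (- k) \<le> G (t - s) (x - y)"
        using ts e yx by (intro c0) auto
      moreover have "0 < c0 * (t - s) powr (- k)" using c0 ts e by simp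
      ultimately have "ennreal (G (t - s) (x - y)) \<noteq> 0" by (simp add: ennreal_eq_0_iff)
      thus "\<infinity> \<le> ennreal (G (t - s) (x - y)) * enn_powr (V s y) (1 + \<eta>)"
        unfolding 1 by (simp add: ennreal_mult_top)
    qed auto
    finally show ?thesis by (simp add: top_unique)
  qed
  thus ?thesis using T0 by (intro exI[of _ "2 * T0"]) auto
qed

end

theorem theorem1p1:
  fixes \<alpha> \<beta> \<eta> :: real
    and V0 :: "'a::euclidean_space \<Rightarrow> real"
    and V :: "real \<Rightarrow> 'a \<Rightarrow> ennreal"
  assumes "0 < \<alpha>" "\<alpha> < 2" "0 < \<beta>" "\<beta> < 1"
    and "0 < \<eta>" "\<eta> \<le> \<alpha> / (\<beta> * real DIM('a))"
    and "V0 \<in> borel_measurable lborel" "\<forall>x. 0 \<le> V0 x"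
    and "\<not> (AE x in lborel. V0 x = 0)"
    and "(\<lambda>z. V (fst z) (snd z)) \<in> borel_measurable (restrict_space borel ({0<..} \<times> UNIV))"
    and "\<forall>t>0. \<forall>x. V t x =
           (\<integral>\<^sup>+ y. ennreal (Gkernel \<alpha> \<beta> t (x - y) * V0 y) \<partial>lborel) +
           (\<integral>\<^sup>+ y. (\<integral>\<^sup>+ s\<in>{0<..<t}. ennreal (Gkernel \<alpha> \<beta> (t - s) (x - y)) * enn_powr (V s y) (1 + \<eta>) \<partial>lborel) \<partial>lborel)"
  shows "\<exists>t0>0. \<forall>t>t0. \<forall>x. V t x = \<infinity>"
proof -
  \<comment> \<open>With k = \<beta> d / \<alpha>, the bound \<eta> \<le> \<alpha> / (\<beta> d) is
    exactly k \<eta> \<le> 1.\<close>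
  interpret duhamel "Gkernel \<alpha> \<beta>" V0 V "\<beta> / \<alpha>" "\<beta> * real DIM('a) / \<alpha>" \<eta>
  proof
    show "0 < \<beta> / \<alpha>" "0 < \<eta>" using assms by auto
    show "\<beta> * real DIM('a) / \<alpha> = \<beta> / \<alpha> * real DIM('a)" by simp
    show "\<beta> * real DIM('a) / \<alpha> * \<eta> \<le> 1"
      using assms(1,3,6) by (simp add: field_simps)
    show "\<exists>c>0. \<forall>t>0. \<forall>z::'a. z \<noteq> 0 \<longrightarrow> norm z \<le> M * t powr (\<beta> / \<alpha>) \<longrightarrow>
        c * t powr (- (\<beta> * real DIM('a) / \<alpha>)) \<le> Gkernel \<alpha> \<beta> t z" for M
      using Gkernel_lower[OF assms(1-4), of M] by metis
    show "V0 \<in> borel_measurable lborel" "\<And>x. 0 \<le> V0 x" "\<not> (AE x in lborel. V0 x = 0)"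
      using assms(7-9) by auto
  qed (use assms(11) in blast)
  show ?thesis by (rule global_blowup)
qed

end
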